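(* Let $m\ge1$ be an integer, let $s\in\mathbb{Z}$, and suppose that the symbol $w$ and $s$ are such that $E^{(s)}_n\neq0$ for $n\in\{2m,2m-1,2m-2\}$ and $$\frac{E^{(s+1)}_{2m}\widehat{E}^{(s)}_{2m-1}-E^{(s+1)}_{2m-1}\widehat{E}^{(s)}_{2m}}{E^{(s)}_{2m}E^{(s)}_{2m-1}}\neq0.$$ Define $$\boldsymbol{X}_{m}(z;s):=\boldsymbol{B}_m(s)^{-1}\begin{pmatrix}S^*_{2m}(z;s)&\frac{1}{2z}\left(S^*_{2m}(z;s)-S^*_{2m}(-z;s)\right)&H_{2m}(z;s)\\ zS^*_{2m-1}(z;s)&\frac12\left(S^*_{2m-1}(z;s)+S^*_{2m-1}(-z;s)\right)&H_{2m-1}(z;s)\\ z^2S^*_{2m-2}(z;s)&\frac z2\left(S^*_{2m-2}(z;s)-S^*_{2m-2}(-z;s)\right)&H_{2m-2}(z;s)\end{pmatrix},$$ $$\boldsymbol{B}_m(s):=\begin{pmatrix}S_{2m}(0;s)&S'_{2m}(0;s)&0\\S_{2m-1}(0;s)&S'_{2m-1}(0;s)&0\\S_{2m-2}(0;s)&S'_{2m-2}(0;s)&-2g^{(s)}_{2m-2}\end{pmatrix}.$$ Then $\boldsymbol{X}_m(z;s)$ is uniquely well-defined by this formula and satisfies the following Riemann-Hilbert problem. (X1) The matrix-valued function $\boldsymbol{X}_m(\cdot;s):\mathbb{C}\setminus\mathbb{T}\to\mathbb{C}^{3\times3}$ is holomorphic. (X2) On the unit circle, $$\boldsymbol{X}_{m,+}(z;s)=\boldsymbol{X}_{m,-}(z;s)\begin{pmatrix}1&0&k_1(z;m,s)\\0&1&k_2(z;m,s)\\0&0&1\end{pmatrix},\qquad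 z\in\mathbb{T},$$ where $k_1(z;m,s)=z^{-2m-s-2}\left[w(z)+(-1)^sw(-z)\right]$ and $k_2(z;m,s)=2(-1)^{s+1}z^{-2m-s-1}w(-z)$. (X3) As $z\to\infty$, $$\boldsymbol{X}_m(z;s)=\left(I+\frac{\overset{\infty}{\boldsymbol{X}}_1(m,s)}{z}+\frac{\overset{\infty}{\boldsymbol{X}}_2(m,s)}{z^2}+O(z^{-3})\right)\begin{pmatrix}z^{2m}&0&0\\0&z^{2m-2}&0\\0&0&z^{-4m+2}\end{pmatrix},\qquad \overset{\infty}{\boldsymbol{X}}_1(m,s)=\begin{pmatrix}0&0&0\\1&0&0\\0&0&0\end{pmatrix}.$$ In addition, the third column of $\boldsymbol{X}_m$ has the refined expansion $$\boldsymbol{X}^{(3)}_m(z;s)=z^{-4m+2}\left(\boldsymbol{e}_3+\frac{\boldsymbol{\phi}}{z^2}+O(z^{-4})\right),\qquad z\to\infty,$$ where $\boldsymbol{e}_3=(0,0,1)^T$ and $\boldsymbol{\phi}\in\mathbb{C}^3$ is a constant vector. If $\boldsymbol{v}(z):=\boldsymbol{X}^{(1)}_m(z;s)$ denotes the first column and $\boldsymbol{v}_j:=\frac{1}{j!}\frac{d^j}{dz^j}\boldsymbol{v}(0)$, $j=0,1,2$, then $$\operatorname{rank}\begin{pmatrix}\boldsymbol{v}_0&\boldsymbol{e}_3&\boldsymbol{\phi}\end{pmatrix}=\operatorname{rank}\begin{pmatrix}\boldsymbol{v}_0&\boldsymbol{v}_1&\boldsymbol{e}_3\end{pmatrix}=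\operatorname{rank}\begin{pmatrix}\boldsymbol{v}_0&\boldsymbol{v}_1&\boldsymbol{v}_2\end{pmatrix}=3.$$
   Context: $\mathbb{T}$ is the unit circle, oriented counterclockwise; the subscripts $+$ and $-$ denote boundary values on $\mathbb{T}$ from the inside and the outside respectively. $w$ is a weight function (symbol) on $\mathbb{T}$, regular enough that the Plemelj–Sokhotskii formula holds (with continuous boundary values) for Cauchy transforms over $\mathbb{T}$ of $w$ times Laurent polynomials. Its moments are $w_\ell=\int_{\mathbb{T}} w(\zeta)\zeta^{-\ell}\frac{d\zeta}{2\pi \mathrm{i}\zeta}$, $\ell\in\mathbb{Z}$. For $t\in\mathbb{Z}$, $E^{(t)}_n:=\det(w_{j-2k+t})_{0\le j,k\le n-1}$, with $E^{(t)}_0:=1$, and $g_n^{(s)}:=E^{(s)}_{n+1}/E^{(s)}_n$. $\widehat{E}^{(s)}_n$ is the $n\times n$ determinant $\det(w_{a_j-2k+s})_{0\le j,k\le n-1}$ with row indices $a_0=0$ and $a_j=j+1$ for $1\le j\le n-1$ (i.e. first row $w_s,w_{s-2},\dots,w_{s-2n+2}$, second row $w_{s+2},w_s,\dots,w_{s-2n+4}$, ..., last row $w_{s+n},w_{s+n-2},\dots,w_{s-n+2}$). When $E_n^{(s)}\neq0$, $S_n(z;s)$ is the unique monic polynomial of degree $n$ with $\int_{\mathbb{T}}S_n(\zeta^{-1};s)\zeta^{2k-s}w(\zeta)\frac{d\zeta}{2\pi \mathrm{i}\zeta}=0$ for $k=0,\dots,n-1$; it is given by $1/E^{(s)}_n$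 times the determinant of the $(n+1)\times(n+1)$ matrix whose row $j$, $0\le j\le n$, is $(w_{s+j},w_{s+j-2},\dots,w_{s+j-2n+2},z^j)$. $S_n'$ is its derivative in $z$, and $S_n^*(z;s):=z^nS_n(z^{-1};s)$ is the reciprocal polynomial. Finally $$H_n(z;s):=2\int_{\mathbb{T}}S_n(\zeta^{-1};s)w(\zeta)\zeta^{-s}\frac{1}{\zeta^2-z^2}\frac{d\zeta}{2\pi \mathrm{i}\zeta}.$$ *)

theory Defs
  imports "HOL-Complex_Analysis.Complex_Analysis" "HOL-Library.Landau_Symbols"
    "Jordan_Normal_Form.Determinant"
begin

no_notation Matrix.vec_index (infixl "$" 100)

definition circle_mean :: "(complex \<Rightarrow> complex) \<Rightarrow> complex" where
  "circle_mean f = contour_integral (circlepath 0 1) (\<lambda>\<zeta>. f \<zeta> / (2 * of_real pi * \<i> * \<zeta>))"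

definition cauchy_transform :: "(complex \<Rightarrow> complex) \<Rightarrow> complex \<Rightarrow> complex" where
  "cauchy_transform f z =
     contour_integral (circlepath 0 1) (\<lambda>\<zeta>. f \<zeta> / (\<zeta> - z)) / (2 * of_real pi * \<i>)"

text \<open>Continuous boundary values on the unit circle: the first limit function is taken from
  inside the circle (the + side of the counterclockwise orientation), the second one from
  outside. The limits are unrestricted, that is, not merely nontangential.\<close>

definition boundary_values ::
  "(complex \<Rightarrow> 'a::topological_space) \<Rightarrow> (complex \<Rightarrow> 'a) \<Rightarrow> (complex \<Rightarrow> 'a) \<Rightarrow> bool" where
  "boundary_values f fp fm \<longleftrightarrow>
     continuous_on (sphere 0 1) fp \<and> continuous_on (sphere 0 1) fm \<and>
     (\<forall>z\<in>sphere 0 1. (f \<longlongrightarrow> fp z) (at z within ball 0 1) \<and>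
                      (f \<longlongrightarrow> fm z) (at z within - cball 0 1))"

text \<open>Regularity of the symbol: the Plemelj-Sokhotskii formula, with continuous boundary
  values, for the Cauchy transform of the symbol times any Laurent polynomial
  \<open>p(\<zeta>) \<zeta>\<^sup>l\<close> with \<open>l \<in> \<int>\<close>. Continuity of the symbol is already the case
  \<open>p = 1\<close>, \<open>l = 0\<close> of the jump relation; it is listed to make clear that all the
  contour integrals exist.\<close>

definition plemelj_symbol :: "(complex \<Rightarrow> complex) \<Rightarrow> bool" where
  "plemelj_symbol w \<longleftrightarrow>
     continuous_on (sphere 0 1) w \<and>
     (\<forall>(p::complex poly) (l::int). \<exists>Cp Cm.
        boundary_values (cauchy_transform (\<lambda>\<zeta>. w \<zeta> * (poly p \<zeta> * \<zeta> powi l))) Cp Cm \<and>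
        (\<forall>z\<in>sphere 0 1. Cp z - Cm z = w z * (poly p z * z powi l)))"

definition moment :: "(complex \<Rightarrow> complex) \<Rightarrow> int \<Rightarrow> complex" where
  "moment w l = circle_mean (\<lambda>\<zeta>. w \<zeta> * \<zeta> powi (- l))"

definition E_det :: "(complex \<Rightarrow> complex) \<Rightarrow> int \<Rightarrow> nat \<Rightarrow> complex" where
  "E_det w t n =
     Determinant.det (Matrix.mat n n (\<lambda>(j, k). moment w (int j - 2 * int k + t)))"

definition Ehat_det :: "(complex \<Rightarrow> complex) \<Rightarrow> int \<Rightarrow> nat \<Rightarrow> complex" where
  "Ehat_det w s n =
     Determinant.det (Matrix.mat n n (\<lambda>(j, k).
       moment w ((if j = 0 then 0 else int j + 1) - 2 * int k + s)))"

definition g_const :: "(complex \<Rightarrow> complex) \<Rightarrow> int \<Rightarrow> nat \<Rightarrow> complex" where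
  "g_const w s n = E_det w s (n + 1) / E_det w s n"

definition is_S :: "(complex \<Rightarrow> complex) \<Rightarrow> int \<Rightarrow> nat \<Rightarrow> complex poly \<Rightarrow> bool" where
  "is_S w s n p \<longleftrightarrow> degree p = n \<and> lead_coeff p = 1 \<and>
     (\<forall>k<n. circle_mean (\<lambda>\<zeta>. poly p (inverse \<zeta>) * \<zeta> powi (2 * int k - s) * w \<zeta>) = 0)"

text \<open>Meaningful when \<open>E_det w s n \<noteq> 0\<close>.\<close>

definition S_poly :: "(complex \<Rightarrow> complex) \<Rightarrow> int \<Rightarrow> nat \<Rightarrow> complex poly" where
  "S_poly w s n = (THE p. is_S w s n p)"

text \<open>As \<open>S_poly w s n\<close> has degree exactly \<open>n\<close>, its reflected polynomial is
  \<open>z\<^sup>n S\<^sub>n(1/z)\<close>, including the value at \<open>z = 0\<close>.\<close>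

definition S_star :: "(complex \<Rightarrow> complex) \<Rightarrow> int \<Rightarrow> nat \<Rightarrow> complex poly" where
  "S_star w s n = reflect_poly (S_poly w s n)"

definition H_integrand ::
  "(complex \<Rightarrow> complex) \<Rightarrow> int \<Rightarrow> nat \<Rightarrow> complex \<Rightarrow> complex \<Rightarrow> complex" where
  "H_integrand w s n z \<zeta> =
     poly (S_poly w s n) (inverse \<zeta>) * w \<zeta> * \<zeta> powi (- s) * (1 / (\<zeta>\<^sup>2 - z\<^sup>2))"

definition H_fun :: "(complex \<Rightarrow> complex) \<Rightarrow> int \<Rightarrow> nat \<Rightarrow> complex \<Rightarrow> complex" where
  "H_fun w s n z = 2 * circle_mean (H_integrand w s n z)"

text \<open>The polynomial \<open>(p(z) - p(-z)) / (2z)\<close>; at \<open>z = 0\<close> the division is understood by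
  cancellation, which leaves the linear coefficient of \<open>p\<close>.\<close>

definition odd_quotient :: "complex poly \<Rightarrow> complex \<Rightarrow> complex" where
  "odd_quotient p z =
     (if z = 0 then coeff p 1 else 1 / (2 * z) * (poly p z - poly p (- z)))"

definition B_mat :: "(complex \<Rightarrow> complex) \<Rightarrow> nat \<Rightarrow> int \<Rightarrow> complex^3^3" where
  "B_mat w m s =
     vector [
       vector [poly (S_poly w s (2*m)) 0, poly (pderiv (S_poly w s (2*m))) 0, 0],
       vector [poly (S_poly w s (2*m - 1)) 0, poly (pderiv (S_poly w s (2*m - 1))) 0, 0],
       vector [poly (S_poly w s (2*m - 2)) 0, poly (pderiv (S_poly w s (2*m - 2))) 0,
               - 2 * g_const w s (2*m - 2)]]"

definition X_raw :: "(complex \<Rightarrow> complex) \<Rightarrow> nat \<Rightarrow> int \<Rightarrow> complex \<Rightarrow> complex^3^3" where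
  "X_raw w m s z =
     vector [
       vector [poly (S_star w s (2*m)) z,
               odd_quotient (S_star w s (2*m)) z,
               H_fun w s (2*m) z],
       vector [z * poly (S_star w s (2*m - 1)) z,
               1 / 2 * (poly (S_star w s (2*m - 1)) z + poly (S_star w s (2*m - 1)) (- z)),
               H_fun w s (2*m - 1) z],
       vector [z\<^sup>2 * poly (S_star w s (2*m - 2)) z,
               z / 2 * (poly (S_star w s (2*m - 2)) z - poly (S_star w s (2*m - 2)) (- z)),
               H_fun w s (2*m - 2) z]]"

definition X_mat :: "(complex \<Rightarrow> complex) \<Rightarrow> nat \<Rightarrow> int \<Rightarrow> complex \<Rightarrow> complex^3^3" where
  "X_mat w m s z = matrix_inv (B_mat w m s) ** X_raw w m s z"

definition k1 :: "(complex \<Rightarrow> complex) \<Rightarrow> nat \<Rightarrow> int \<Rightarrow> complex \<Rightarrow> complex" where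
  "k1 w m s z = z powi (- 2 * int m - s - 2) * (w z + (- 1) powi s * w (- z))"

definition k2 :: "(complex \<Rightarrow> complex) \<Rightarrow> nat \<Rightarrow> int \<Rightarrow> complex \<Rightarrow> complex" where
  "k2 w m s z = 2 * (- 1) powi (s + 1) * z powi (- 2 * int m - s - 1) * w (- z)"

definition jump_mat :: "(complex \<Rightarrow> complex) \<Rightarrow> nat \<Rightarrow> int \<Rightarrow> complex \<Rightarrow> complex^3^3" where
  "jump_mat w m s z =
     vector [vector [1, 0, k1 w m s z], vector [0, 1, k2 w m s z], vector [0, 0, 1]]"

definition asym_mat :: "nat \<Rightarrow> complex \<Rightarrow> complex^3^3" where
  "asym_mat m z =
     vector [vector [z powi (2 * int m), 0, 0],
             vector [0, z powi (2 * int m - 2), 0],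
             vector [0, 0, z powi (- 4 * int m + 2)]]"

definition X1_inf :: "complex^3^3" where
  "X1_inf = vector [vector [0, 0, 0], vector [1, 0, 0], vector [0, 0, 0]]"

abbreviation e3 :: "complex^3" where
  "e3 \<equiv> axis 3 1"

text \<open>The Taylor coefficient \<open>v\<^sub>j\<close> at 0 of the first column of \<open>X_mat\<close>.\<close>

definition v_coeff :: "(complex \<Rightarrow> complex) \<Rightarrow> nat \<Rightarrow> int \<Rightarrow> nat \<Rightarrow> complex^3" where
  "v_coeff w m s j =
     (\<chi> i. 1 / fact j * (deriv ^^ j) (\<lambda>z. column 1 (X_mat w m s z) $ i) 0)"

definition of_columns :: "complex^3 \<Rightarrow> complex^3 \<Rightarrow> complex^3 \<Rightarrow> complex^3^3" where
  "of_columns a b c = transpose (vector [a, b, c])"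

end

theory Submission
  imports Defs
begin

text \<open>
The construction works row by row. Write \<open>n\<^sub>1 = 2m\<close>, \<open>n\<^sub>2 = 2m - 1\<close>,
\<open>n\<^sub>3 = 2m - 2\<close> and \<open>S\<^sub>i\<close> for the orthogonal polynomial of degree \<open>n\<^sub>i\<close>. The powers
of \<open>z\<close> in the rows of the matrix that \<open>B\<^sup>-\<^sup>1\<close> multiplies are chosen such that all three rows have the
same shape: for \<open>z \<noteq> 0\<close>, row \<open>i\<close> is
\<open>(z\<^sup>2\<^sup>m S\<^sub>i(1/z), z\<^sup>2\<^sup>m\<^sup>-\<^sup>2 T\<^sub>i(1/z), H\<^bsub>n\<^sub>i\<^esub>(z))\<close>, where \<open>T\<^sub>i(x) = (S\<^sub>i(x) - S\<^sub>i(-x)) / (2x)\<close>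
(lemmas \<open>X_raw_column1\<close>, \<open>X_raw_column2\<close>). Each claim is proved for such a row; left multiplication by
the constant matrix \<open>B\<^sup>-\<^sup>1\<close> then affects only the normalisation.

\<^item> \<^emph>\<open>Determinants.\<close> Expanding the bordered determinant of \<open>S\<^sub>n\<close> along its last column
  gives \<open>S\<^sub>n(0) = (-1)\<^sup>n E\<^sub>n\<^sup>(\<^sup>s\<^sup>+\<^sup>1\<^sup>) / E\<^sub>n\<^sup>(\<^sup>s\<^sup>)\<close> and, with the opposite sign, \<open>S\<^sub>n'(0)\<close> from the minor
  that leaves out the second row. So \<open>det B\<close> is \<open>-2 g\<^bsub>2m-2\<^esub>\<close> times the quantity
  assumed to be nonzero (\<open>det_B_mat\<close>).

\<^item> \<^emph>\<open>Jump.\<close> From \<open>2/(\<zeta>\<^sup>2 - z\<^sup>2) = (1/\<zeta>)(1/(\<zeta> - z) + 1/(\<zeta> + z))\<close> one gets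
  \<open>H\<^sub>n(z) = Cf(z) + Cf(-z)\<close>, where \<open>C\<close> is the Cauchy transform and
  \<open>f(\<zeta>) = S\<^sub>n(1/\<zeta>) w(\<zeta>) \<zeta>\<^sup>-\<^sup>s\<^sup>-\<^sup>2\<close> (\<open>H_fun_eq_cauchy_transform\<close>). Since \<open>z \<mapsto> -z\<close> keeps the sides of the
  circle, the Plemelj-Sokhotskii formula gives the jump \<open>f(z) + f(-z)\<close>. The terms with \<open>w(-z)\<close> in
  \<open>k\<^sub>1\<close> and \<open>k\<^sub>2\<close> are such that the combination of the first two columns equals this sum
  (\<open>H_density_pair\<close>).

\<^item> \<^emph>\<open>Infinity.\<close> The first two columns are expanded by Taylor's formula for \<open>S\<^sub>i\<close> and \<open>T\<^sub>i\<close> at \<open>0\<close>; their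
  leading coefficients are \<open>S\<^sub>i(0)\<close> and \<open>S\<^sub>i'(0)\<close>, the entries of \<open>B\<close>. Moreover \<open>T\<^sub>i\<close> is even, and the
  coefficient of \<open>1/z\<close> in the first column is again the second column of \<open>B\<close>; this is the form of the
  \<open>1/z\<close> term. For the third column, the geometric series of \<open>1/(\<zeta>\<^sup>2 - z\<^sup>2)\<close> and orthogonality leave
  \<open>H\<^sub>n(z) = z\<^sup>-\<^sup>2\<^sup>n\<^sup>-\<^sup>2 (-2 g\<^sub>n + O(z\<^sup>-\<^sup>2))\<close>. Hence the three rows start at \<open>z\<^sup>-\<^sup>4\<^sup>m\<^sup>-\<^sup>2\<close>, \<open>z\<^sup>-\<^sup>4\<^sup>m\<close> and
  \<open>z\<^sup>-\<^sup>4\<^sup>m\<^sup>+\<^sup>2\<close>, and \<open>B \<phi> = (0, -2 g\<^bsub>2m-1\<^esub>, *)\<close>.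

\<^item> \<^emph>\<open>Ranks.\<close> After multiplication by \<open>B\<close>, each of the three matrices is triangular up to the order of
  its columns. Row \<open>i\<close> of the first column is a polynomial with lowest term \<open>z\<^sup>i\<^sup>-\<^sup>1\<close>, because \<open>S\<^sub>i\<close> is monic,
  \<open>B e\<^sub>3 = (0, 0, -2 g\<^bsub>2m-2\<^esub>)\<close>, and \<open>g\<^bsub>2m-1\<^esub>\<close> and \<open>g\<^bsub>2m-2\<^esub>\<close> are nonzero.
\<close>

(* Coefficients of power series and entries of vectors share this symbol, so the number of parses of
   an expression grows exponentially with the number of vector entries in it. *)
no_notation fps_nth (infixl \<open>$\<close> 75)

section \<open>Means over the unit circle\<close>

lemma circle_integrable:
  assumes "continuous_on (sphere 0 1) f"
  shows "f contour_integrable_on circlepath 0 1"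
  using assms by (intro contour_integrable_continuous_circlepath) simp

lemma circle_mean_integrable:
  assumes "continuous_on (sphere 0 1) f"
  shows "(\<lambda>\<zeta>. f \<zeta> / (2 * of_real pi * \<i> * \<zeta>)) contour_integrable_on circlepath 0 1"
  by (intro circle_integrable continuous_intros assms) auto

lemma circle_mean_cong:
  assumes "\<And>\<zeta>. norm \<zeta> = 1 \<Longrightarrow> f \<zeta> = g \<zeta>"
  shows "circle_mean f = circle_mean g"
  unfolding circle_mean_def
  by (rule contour_integral_cong) (use assms in auto)

lemma circle_mean_linear:
  assumes "finite A" "\<And>a. a \<in> A \<Longrightarrow> continuous_on (sphere 0 1) (f a)"
  shows "circle_mean (\<lambda>\<zeta>. \<Sum>a\<in>A. c a * f a \<zeta>) = (\<Sum>a\<in>A. c a * circle_mean (f a))"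
proof -
  have "circle_mean (\<lambda>\<zeta>. \<Sum>a\<in>A. c a * f a \<zeta>) =
      contour_integral (circlepath 0 1) (\<lambda>\<zeta>. \<Sum>a\<in>A. c a * (f a \<zeta> / (2 * of_real pi * \<i> * \<zeta>)))"
    unfolding circle_mean_def by (simp add: sum_divide_distrib)
  also have "\<dots> = (\<Sum>a\<in>A. contour_integral (circlepath 0 1) (\<lambda>\<zeta>. c a * (f a \<zeta> / (2 * of_real pi * \<i> * \<zeta>))))"
    using assms by (intro contour_integral_sum contour_integrable_lmul circle_mean_integrable)
  also have "\<dots> = (\<Sum>a\<in>A. c a * circle_mean (f a))"
    unfolding circle_mean_def
    using assms by (intro sum.cong refl contour_integral_lmul circle_mean_integrable)
  finally show ?thesis .
qed

section \<open>The orthogonal polynomials as bordered determinants\<close>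

text \<open>The pairing of \<open>p(1/\<zeta>)\<close> with \<open>\<zeta>\<^bsup>2k-s\<^esup>\<close> against the symbol, written in moments; this turns the
  orthogonality conditions into a linear system for the coefficients of \<open>p\<close>.\<close>

definition pairing :: "(complex \<Rightarrow> complex) \<Rightarrow> int \<Rightarrow> complex poly \<Rightarrow> int \<Rightarrow> complex" where
  "pairing w s p k = (\<Sum>j\<le>degree p. coeff p j * moment w (int j - 2 * k + s))"

lemma pairing_upto:
  assumes "degree p \<le> n"
  shows "pairing w s p k = (\<Sum>j\<le>n. coeff p j * moment w (int j - 2 * k + s))"
  unfolding pairing_def using assms
  by (intro sum.mono_neutral_left) (auto simp: coeff_eq_0)

lemma circle_mean_pairing:
  assumes "continuous_on (sphere 0 1) w"
  shows "circle_mean (\<lambda>\<zeta>. poly p (inverse \<zeta>) * \<zeta> powi (2 * k - s) * w \<zeta>) = pairing w s p k"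
proof -
  have "circle_mean (\<lambda>\<zeta>. poly p (inverse \<zeta>) * \<zeta> powi (2 * k - s) * w \<zeta>) =
      circle_mean (\<lambda>\<zeta>. \<Sum>j\<le>degree p. coeff p j * (w \<zeta> * \<zeta> powi (- (int j - 2 * k + s))))"
  proof (rule circle_mean_cong)
    fix \<zeta> :: complex assume "norm \<zeta> = 1"
    then have "\<zeta> \<noteq> 0" by auto
    have "inverse \<zeta> ^ j * \<zeta> powi (2 * k - s) = \<zeta> powi (- (int j - 2 * k + s))" for j
    proof -
      have "inverse \<zeta> ^ j = \<zeta> powi (- int j)"
        by (simp add: power_int_minus power_inverse)
      then show ?thesis
        using \<open>\<zeta> \<noteq> 0\<close> by (simp flip: power_int_add add: algebra_simps)
    qed
    then show "poly p (inverse \<zeta>) * \<zeta> powi (2 * k - s) * w \<zeta> =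
      (\<Sum>j\<le>degree p. coeff p j * (w \<zeta> * \<zeta> powi (- (int j - 2 * k + s))))"
      unfolding poly_altdef sum_distrib_right
      by (intro sum.cong refl) (metis mult.assoc mult.commute)
  qed
  also have "\<dots> = pairing w s p k"
    unfolding pairing_def moment_def
    by (subst circle_mean_linear) (auto intro!: continuous_intros assms)
  finally show ?thesis .
qed

text \<open>The minor of the bordered matrix that belongs to the entry \<open>z\<^sup>j\<close> of its last column: row \<open>j\<close>
  is left out, and the last column as well.\<close>

definition bordered_minor :: "(complex \<Rightarrow> complex) \<Rightarrow> int \<Rightarrow> nat \<Rightarrow> nat \<Rightarrow> complex" where
  "bordered_minor w s n j =
     Determinant.det (Matrix.mat n n (\<lambda>(i, k). moment w (int (insert_index j i) - 2 * int k + s)))"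

text \<open>The last column stays arbitrary because it is used with three kinds of entries: the powers of
  \<open>z\<close> give the polynomial itself, the moments of an earlier column give orthogonality, and those of
  the next column give \<open>E_det w s (n + 1)\<close>.\<close>

lemma bordered_det_expand:
  "Determinant.det (Matrix.mat (Suc n) (Suc n)
      (\<lambda>(j, k). if k < n then moment w (int j - 2 * int k + s) else u j)) =
    (\<Sum>j\<le>n. u j * ((- 1) ^ (j + n) * bordered_minor w s n j))"
    (is "Determinant.det ?A = _")
proof -
  have "Determinant.det ?A = (\<Sum>j<Suc n. ?A $$ (j, n) * cofactor ?A j n)"
    by (rule laplace_expansion_column) auto
  also have "\<dots> = (\<Sum>j\<le>n. u j * ((- 1) ^ (j + n) * bordered_minor w s n j))"
  proof (rule sum.cong)
    fix j assume "j \<in> {..n}"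
    have "mat_delete ?A j n =
        Matrix.mat n n (\<lambda>(i, k). moment w (int (insert_index j i) - 2 * int k + s))"
      using \<open>j \<in> {..n}\<close> by (intro eq_matI) (auto simp: mat_delete_def insert_index_def)
    then show "?A $$ (j, n) * cofactor ?A j n = u j * ((- 1) ^ (j + n) * bordered_minor w s n j)"
      using \<open>j \<in> {..n}\<close> by (simp add: Determinant.cofactor_def bordered_minor_def)
  qed auto
  finally show ?thesis .
qed

lemma bordered_minor_last: "bordered_minor w s n n = E_det w s n"
  unfolding bordered_minor_def E_det_def
  by (rule arg_cong[where f = Determinant.det]) (auto intro!: eq_matI)

lemma bordered_minor_0: "bordered_minor w s n 0 = E_det w (s + 1) n"
  unfolding bordered_minor_def E_det_def
  by (rule arg_cong[where f = Determinant.det]) (auto intro!: eq_matI simp: algebra_simps)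

lemma bordered_minor_1: "bordered_minor w s n 1 = Ehat_det w s n"
  unfolding bordered_minor_def Ehat_det_def
  by (rule arg_cong[where f = Determinant.det])
     (auto intro!: eq_matI simp: insert_index_def algebra_simps)

definition bordered_poly :: "(complex \<Rightarrow> complex) \<Rightarrow> int \<Rightarrow> nat \<Rightarrow> complex poly" where
  "bordered_poly w s n =
     (\<Sum>j\<le>n. monom ((- 1) ^ (j + n) * bordered_minor w s n j / E_det w s n) j)"

lemma coeff_bordered_poly:
  "coeff (bordered_poly w s n) j =
     (if j \<le> n then (- 1) ^ (j + n) * bordered_minor w s n j / E_det w s n else 0)"
  by (simp add: bordered_poly_def coeff_sum sum.delta)

lemma
  assumes "E_det w s n \<noteq> 0"
  shows degree_bordered_poly: "degree (bordered_poly w s n) = n"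
    and coeff_bordered_poly_top: "coeff (bordered_poly w s n) n = 1"
proof -
  show "coeff (bordered_poly w s n) n = 1"
    using assms by (simp add: coeff_bordered_poly bordered_minor_last)
  then show "degree (bordered_poly w s n) = n"
    by (intro antisym degree_le le_degree) (auto simp: coeff_bordered_poly)
qed

lemma pairing_bordered_poly:
  assumes "E_det w s n \<noteq> 0"
  shows "pairing w s (bordered_poly w s n) k =
    Determinant.det (Matrix.mat (Suc n) (Suc n)
      (\<lambda>(j, i). if i < n then moment w (int j - 2 * int i + s) else moment w (int j - 2 * k + s)))
      / E_det w s n"
  unfolding bordered_det_expand
  using degree_bordered_poly[OF assms]
  by (simp add: pairing_def coeff_bordered_poly sum_divide_distrib mult_ac)

text \<open>For \<open>k < n\<close>, the last column of the bordered matrix repeats column \<open>k\<close>.\<close>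

lemma pairing_bordered_poly_less:
  assumes "E_det w s n \<noteq> 0" "k < n"
  shows "pairing w s (bordered_poly w s n) (int k) = 0"
proof -
  let ?A = "Matrix.mat (Suc n) (Suc n)
      (\<lambda>(j, i). if i < n then moment w (int j - 2 * int i + s) else moment w (int j - 2 * int k + s))"
  have "Determinant.det ?A = 0"
    by (rule Determinant.det_identical_columns[of _ "Suc n" k n]) (use assms in \<open>auto intro!: eq_vecI\<close>)
  then show ?thesis
    using pairing_bordered_poly[OF assms(1)] by simp
qed

lemma pairing_bordered_poly_eq:
  assumes "E_det w s n \<noteq> 0"
  shows "pairing w s (bordered_poly w s n) (int n) = g_const w s n"
proof -
  have "Matrix.mat (Suc n) (Suc n)
      (\<lambda>(j, i). if i < n then moment w (int j - 2 * int i + s) else moment w (int j - 2 * int n + s)) =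
    Matrix.mat (n + 1) (n + 1) (\<lambda>(j, k). moment w (int j - 2 * int k + s))"
    by (rule eq_matI) (auto simp: less_Suc_eq)
  then show ?thesis
    using pairing_bordered_poly[OF assms] by (simp add: g_const_def E_det_def)
qed

lemma is_S_iff:
  assumes "continuous_on (sphere 0 1) w"
  shows "is_S w s n p \<longleftrightarrow> degree p = n \<and> coeff p n = 1 \<and> (\<forall>k<n. pairing w s p (int k) = 0)"
  unfolding is_S_def circle_mean_pairing[OF assms] by auto

text \<open>The difference of two solutions has degree less than \<open>n\<close>, so its coefficients solve the
  homogeneous system whose determinant is \<open>E_det w s n\<close>.\<close>

lemma is_S_unique:
  assumes "continuous_on (sphere 0 1) w" "E_det w s n \<noteq> 0" "is_S w s n p" "is_S w s n q"
  shows "p = q"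
proof -
  define d where "d = p - q"
  have p: "degree p = n" "coeff p n = 1" "\<And>k. k < n \<Longrightarrow> pairing w s p (int k) = 0"
   and q: "degree q = n" "coeff q n = 1" "\<And>k. k < n \<Longrightarrow> pairing w s q (int k) = 0"
    using assms is_S_iff[OF assms(1)] by auto
  have d_high: "coeff d j = 0" if "j \<ge> n" for j
    using that p q by (cases "j = n") (auto simp: d_def coeff_eq_0)
  let ?M = "Matrix.mat n n (\<lambda>(j, k). moment w (int j - 2 * int k + s))"
  define v where "v = Matrix.vec n (coeff d)"
  have "transpose_mat ?M *\<^sub>v v = 0\<^sub>v n"
  proof (rule eq_vecI)
    fix k assume "k < dim_vec (0\<^sub>v n :: complex Matrix.vec)"
    then have k: "k < n" by simp
    have "(\<Sum>j<n. coeff d j * moment w (int j - 2 * int k + s)) =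
        (\<Sum>j\<le>n. coeff d j * moment w (int j - 2 * int k + s))"
      using d_high by (simp add: lessThan_Suc_atMost[symmetric])
    also have "\<dots> = pairing w s p (int k) - pairing w s q (int k)"
      using pairing_upto[of p n w s "int k"] pairing_upto[of q n w s "int k"] p(1) q(1)
      by (simp add: d_def left_diff_distrib sum_subtractf)
    also have "\<dots> = 0" using p q k by simp
    finally show "Matrix.vec_index (transpose_mat ?M *\<^sub>v v) k = Matrix.vec_index (0\<^sub>v n) k"
      using k by (simp add: v_def scalar_prod_def atLeast0LessThan mult.commute)
  qed (auto simp: v_def)
  moreover have "Determinant.det (transpose_mat ?M) \<noteq> 0"
    using assms(2) by (subst Determinant.det_transpose[of _ n]) (auto simp: E_det_def)
  moreover have "v \<in> carrier_vec n" "transpose_mat ?M \<in> carrier_mat n n"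
    by (auto simp: v_def)
  ultimately have "v = 0\<^sub>v n"
    using det_0_iff_vec_prod_zero_field[of "transpose_mat ?M" n] by metis
  then have "coeff d j = 0" if "j < n" for j
    using that by (metis v_def index_vec index_zero_vec(1))
  with d_high have "d = 0" by (metis poly_eqI coeff_0 not_le)
  then show ?thesis by (simp add: d_def)
qed

lemma
  assumes "continuous_on (sphere 0 1) w" "E_det w s n \<noteq> 0"
  shows ex1_is_S: "\<exists>!p. is_S w s n p"
    and S_poly_eq_bordered_poly: "S_poly w s n = bordered_poly w s n"
proof -
  have "is_S w s n (bordered_poly w s n)"
    using degree_bordered_poly coeff_bordered_poly_top pairing_bordered_poly_less assms
    by (simp add: is_S_iff)
  then show "\<exists>!p. is_S w s n p" "S_poly w s n = bordered_poly w s n"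
    unfolding S_poly_def using is_S_unique[OF assms] by blast+
qed

lemma
  assumes "continuous_on (sphere 0 1) w" "E_det w s n \<noteq> 0"
  shows degree_S_poly: "degree (S_poly w s n) = n"
    and coeff_S_poly_top: "coeff (S_poly w s n) n = 1"
    and pairing_S_poly_less: "\<And>k. k < n \<Longrightarrow> pairing w s (S_poly w s n) (int k) = 0"
    and pairing_S_poly_eq: "pairing w s (S_poly w s n) (int n) = g_const w s n"
    and coeff_S_poly_0: "coeff (S_poly w s n) 0 = (- 1) ^ n * E_det w (s + 1) n / E_det w s n"
    and coeff_S_poly_1: "n \<ge> 1 \<Longrightarrow> coeff (S_poly w s n) 1 = (- 1) ^ (n + 1) * Ehat_det w s n / E_det w s n"
  using assms degree_bordered_poly coeff_bordered_poly_top pairing_bordered_poly_less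
    pairing_bordered_poly_eq
  by (simp_all add: S_poly_eq_bordered_poly coeff_bordered_poly bordered_minor_0 bordered_minor_1[simplified])

section \<open>Boundary values on the unit circle\<close>

lemma boundary_values_cong:
  assumes "boundary_values f fp fm" "\<And>z. norm z \<noteq> 1 \<Longrightarrow> g z = f z"
  shows "boundary_values g fp fm"
proof -
  have "\<forall>\<^sub>F x in at z within ball 0 1. f x = g x" for z
    unfolding eventually_at_filter by (rule always_eventually) (use assms(2) in auto)
  moreover have "\<forall>\<^sub>F x in at z within - cball 0 1. f x = g x" for z
    unfolding eventually_at_filter by (rule always_eventually) (use assms(2) in auto)
  ultimately show ?thesis
    using assms(1) unfolding boundary_values_def by (blast intro: Lim_transform_eventually)
qed

lemma boundary_values_continuous:
  assumes "continuous_on UNIV f"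
  shows "boundary_values f f f"
  using assms unfolding boundary_values_def
  by (auto intro: continuous_on_subset tendsto_within_subset[OF _ subset_UNIV]
      simp: continuous_on_def)

lemma boundary_values_add:
  fixes f g :: "complex \<Rightarrow> complex"
  assumes "boundary_values f fp fm" "boundary_values g gp gm"
  shows "boundary_values (\<lambda>z. f z + g z) (\<lambda>z. fp z + gp z) (\<lambda>z. fm z + gm z)"
  using assms unfolding boundary_values_def
  by (auto intro!: continuous_intros tendsto_intros)

text \<open>The reflection maps the inside and the outside of the circle to themselves, so the two
  boundary values are not exchanged.\<close>

lemma boundary_values_reflect:
  assumes "boundary_values f fp fm"
  shows "boundary_values (\<lambda>z. f (- z)) (\<lambda>z. fp (- z)) (\<lambda>z. fm (- z))"
proof -
  have c: "continuous_on (sphere 0 1) (\<lambda>z. h (- z))"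
    if "continuous_on (sphere 0 1) h" for h :: "complex \<Rightarrow> 'a"
    by (rule continuous_on_compose2[OF that]) (auto intro: continuous_intros)
  have l: "((\<lambda>z. f (- z)) \<longlongrightarrow> h (- z)) (at z within A)"
    if "\<And>z. z \<in> sphere 0 1 \<Longrightarrow> (f \<longlongrightarrow> h z) (at z within A)" "z \<in> sphere 0 1"
      "\<And>z. z \<in> A \<Longrightarrow> - z \<in> A" for h and A :: "complex set" and z
  proof -
    have "filterlim uminus (at (- z) within A) (at z within A)"
      unfolding filterlim_at using that(3)
      by (auto simp: eventually_at_filter intro!: tendsto_intros)
    moreover have "(f \<longlongrightarrow> h (- z)) (at (- z) within A)"
      using that(2) by (intro that(1)) simp
    ultimately show ?thesis by (rule filterlim_compose[rotated])
  qed
  show ?thesis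
    using assms unfolding boundary_values_def by (auto intro!: c l)
qed

lemma boundary_values_vec:
  fixes f fp fm :: "complex \<Rightarrow> 'a::topological_space^'n"
  assumes "\<And>i. boundary_values (\<lambda>z. f z $ i) (\<lambda>z. fp z $ i) (\<lambda>z. fm z $ i)"
  shows "boundary_values f fp fm"
  using assms unfolding boundary_values_def
  by (auto intro!: vec_tendstoI simp: continuous_on_def)

lemma boundary_values_matrix_mult:
  fixes A :: "complex^'n^'m" and f fp fm :: "complex \<Rightarrow> complex^'k^'n"
  assumes "\<And>i j. boundary_values (\<lambda>z. f z $ i $ j) (\<lambda>z. fp z $ i $ j) (\<lambda>z. fm z $ i $ j)"
  shows "boundary_values (\<lambda>z. A ** f z) (\<lambda>z. A ** fp z) (\<lambda>z. A ** fm z)"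
proof (intro boundary_values_vec)
  fix i j
  show "boundary_values (\<lambda>z. (A ** f z) $ i $ j) (\<lambda>z. (A ** fp z) $ i $ j) (\<lambda>z. (A ** fm z) $ i $ j)"
    unfolding boundary_values_def matrix_matrix_mult_def vec_lambda_beta
    by (intro conjI ballI continuous_on_sum continuous_on_mult_left tendsto_sum tendsto_mult_left)
       (use assms in \<open>auto simp: boundary_values_def\<close>)
qed

section \<open>The functions \<open>H\<^sub>n\<close> as symmetrised Cauchy transforms\<close>

lemma cauchy_transform_holomorphic:
  assumes "continuous_on (sphere 0 1) f"
  shows "cauchy_transform f holomorphic_on - sphere 0 1"
proof -
  define F where "F w = contour_integral (circlepath 0 1) (\<lambda>u. f u / (u - w) ^ 1)" for w
  have "F field_differentiable at w" if "w \<in> - sphere 0 1" for w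
  proof -
    have int: "((\<lambda>u. f u / (u - w) ^ 1) has_contour_integral F w) (circlepath 0 1)"
      if "w \<in> UNIV - path_image (circlepath 0 1)" for w
      unfolding F_def using that
      by (intro has_contour_integral_integral circle_integrable continuous_intros assms) auto
    have "(F has_field_derivative
        (of_nat 1 * contour_integral (circlepath 0 1) (\<lambda>u. f u / (u - w) ^ Suc 1))) (at w)"
      by (rule Cauchy_next_derivative(2)[where S = UNIV and B = "2 * pi", OF _ _ int])
        (use assms that in \<open>auto simp: vector_derivative_circlepath norm_mult\<close>)
    then show ?thesis by (auto simp: field_differentiable_def)
  qed
  then have "F holomorphic_on - sphere 0 1"
    by (auto simp: holomorphic_on_def intro: field_differentiable_at_within)
  then show ?thesis
    unfolding cauchy_transform_def[abs_def]
    by (auto intro!: holomorphic_intros simp: F_def[abs_def])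
qed

text \<open>This is \<open>S\<^sub>n(1/\<zeta>) w(\<zeta>) \<zeta>\<^bsup>-s-2\<^esup>\<close> on the circle. It is written with the reciprocal polynomial to
  be of the form symbol times polynomial times power, to which the Plemelj-Sokhotskii formula
  applies.\<close>

definition H_density :: "(complex \<Rightarrow> complex) \<Rightarrow> int \<Rightarrow> nat \<Rightarrow> complex \<Rightarrow> complex" where
  "H_density w s n \<zeta> = w \<zeta> * (poly (S_star w s n) \<zeta> * \<zeta> powi (- int n - s - 2))"

lemma continuous_on_H_density:
  assumes "continuous_on (sphere 0 1) w"
  shows "continuous_on (sphere 0 1) (H_density w s n)"
  unfolding H_density_def[abs_def] by (intro continuous_intros assms) auto

lemma H_density_eq:
  assumes "degree (S_poly w s n) = n" "\<zeta> \<noteq> 0"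
  shows "H_density w s n \<zeta> = poly (S_poly w s n) (inverse \<zeta>) * w \<zeta> * \<zeta> powi (- s - 2)"
proof -
  have "\<zeta> ^ n * \<zeta> powi (- int n - s - 2) = \<zeta> powi (- s - 2)"
    using assms(2) by (simp flip: power_int_of_nat power_int_add)
  then show ?thesis
    using assms by (simp add: H_density_def S_star_def poly_reflect_poly_nz)
qed

lemma continuous_on_H_integrand:
  assumes "continuous_on (sphere 0 1) w" "norm z \<noteq> 1"
  shows "continuous_on (sphere 0 1) (H_integrand w s n z)"
proof -
  have "\<zeta>\<^sup>2 \<noteq> z\<^sup>2" if "norm \<zeta> = 1" for \<zeta>
    using that assms(2) by (metis power2_eq_iff norm_minus_cancel)
  then show ?thesis
    unfolding H_integrand_def[abs_def] using assms
    by (intro continuous_intros assms) auto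
qed

text \<open>The partial fractions \<open>2/(\<zeta>\<^sup>2 - z\<^sup>2) = (1/\<zeta>)(1/(\<zeta> - z) + 1/(\<zeta> + z))\<close>. The variant with the
  factor \<open>1/z\<close> and a difference would leave a removable singularity at \<open>z = 0\<close>.\<close>

lemma H_fun_eq_cauchy_transform:
  assumes "continuous_on (sphere 0 1) w" "degree (S_poly w s n) = n" "norm z \<noteq> 1"
  shows "H_fun w s n z = cauchy_transform (H_density w s n) z + cauchy_transform (H_density w s n) (- z)"
proof -
  let ?f = "H_density w s n" and ?C = "circlepath 0 1"
  have nz: "\<zeta> - z \<noteq> 0" "\<zeta> - (- z) \<noteq> 0" if "norm \<zeta> = 1" for \<zeta>
    using that assms(3) by (auto simp: add_eq_0_iff)
  have int: "(\<lambda>\<zeta>. ?f \<zeta> / (\<zeta> - x)) contour_integrable_on ?C" if "x = z \<or> x = - z" for x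
  proof -
    have "norm x \<noteq> 1" using that assms(3) by auto
    then show ?thesis
      by (intro circle_integrable continuous_intros continuous_on_H_density assms) auto
  qed
  have "H_fun w s n z =
      contour_integral ?C (\<lambda>\<zeta>. 2 * (H_integrand w s n z \<zeta> / (2 * of_real pi * \<i> * \<zeta>)))"
    unfolding H_fun_def circle_mean_def
    by (intro contour_integral_lmul[symmetric] circle_mean_integrable continuous_on_H_integrand assms)
  also have "\<dots> = contour_integral ?C
      (\<lambda>\<zeta>. (?f \<zeta> / (\<zeta> - z) + ?f \<zeta> / (\<zeta> - (- z))) / (2 * of_real pi * \<i>))"
  proof (rule contour_integral_cong[OF refl])
    fix \<zeta> assume "\<zeta> \<in> path_image ?C"
    then have \<zeta>: "norm \<zeta> = 1" "\<zeta> \<noteq> 0" by auto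
    have "\<zeta> powi (- s) = \<zeta> powi (- s - 2) * \<zeta>\<^sup>2"
      using \<zeta> by (simp add: power_int_diff)
    moreover have "\<zeta>\<^sup>2 - z\<^sup>2 = (\<zeta> - z) * (\<zeta> - (- z))"
      by (simp add: power2_eq_square algebra_simps)
    ultimately have "H_integrand w s n z \<zeta> = ?f \<zeta> * \<zeta>\<^sup>2 / ((\<zeta> - z) * (\<zeta> - (- z)))"
      using \<zeta>(2) by (simp add: H_integrand_def H_density_eq assms)
    moreover have "2 * \<zeta> / ((\<zeta> - z) * (\<zeta> - (- z))) = 1 / (\<zeta> - z) + 1 / (\<zeta> - (- z))"
      using nz[OF \<zeta>(1)] by (simp add: divide_simps)
    moreover have "2 * (a * \<zeta>\<^sup>2 / d / (c * \<zeta>)) = a * (2 * \<zeta> / d) / c" for a c d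
      using \<zeta>(2) by (simp add: power2_eq_square)
    moreover have "a * (1 / b + 1 / d) / c = (a / b + a / d) / c" for a b c d :: complex
      by (simp add: distrib_left)
    ultimately show "2 * (H_integrand w s n z \<zeta> / (2 * of_real pi * \<i> * \<zeta>)) =
      (?f \<zeta> / (\<zeta> - z) + ?f \<zeta> / (\<zeta> - (- z))) / (2 * of_real pi * \<i>)"
      by metis
  qed
  also have "\<dots> = cauchy_transform ?f z + cauchy_transform ?f (- z)"
    unfolding cauchy_transform_def
    using int[of z, OF disjI1[OF refl]] int[of "- z", OF disjI2[OF refl]]
    by (subst contour_integral_div, intro contour_integrable_add)
       (simp_all only: contour_integral_add add_divide_distrib)
  finally show ?thesis .
qed

lemma H_fun_holomorphic:
  assumes "continuous_on (sphere 0 1) w" "degree (S_poly w s n) = n"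
  shows "H_fun w s n holomorphic_on - sphere 0 1"
proof -
  let ?C = "cauchy_transform (H_density w s n)"
  have C: "?C holomorphic_on - sphere 0 1"
    by (intro cauchy_transform_holomorphic continuous_on_H_density assms)
  have "?C \<circ> uminus holomorphic_on - sphere 0 1"
    by (rule holomorphic_on_compose_gen[OF _ C]) (auto intro: holomorphic_intros)
  then have "(\<lambda>z. ?C (- z)) holomorphic_on - sphere 0 1"
    by (simp add: o_def)
  with C have "(\<lambda>z. ?C z + ?C (- z)) holomorphic_on - sphere 0 1"
    by (intro holomorphic_intros)
  then show ?thesis
    by (rule holomorphic_transform) (use H_fun_eq_cauchy_transform assms in auto)
qed

lemma H_fun_jump:
  assumes "plemelj_symbol w" "degree (S_poly w s n) = n"
  obtains Hp Hm where "boundary_values (H_fun w s n) Hp Hm"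
    "\<And>z. z \<in> sphere 0 1 \<Longrightarrow> Hp z - Hm z = H_density w s n z + H_density w s n (- z)"
proof -
  have w: "continuous_on (sphere 0 1) w"
    using assms(1) by (simp add: plemelj_symbol_def)
  obtain Cp Cm where C: "boundary_values (cauchy_transform (H_density w s n)) Cp Cm"
    and jump: "\<And>z. z \<in> sphere 0 1 \<Longrightarrow> Cp z - Cm z = H_density w s n z"
    using assms(1) unfolding plemelj_symbol_def H_density_def[abs_def] by blast
  have "boundary_values (H_fun w s n) (\<lambda>z. Cp z + Cp (- z)) (\<lambda>z. Cm z + Cm (- z))"
    using boundary_values_add[OF C boundary_values_reflect[OF C]]
    by (rule boundary_values_cong) (use H_fun_eq_cauchy_transform w assms(2) in auto)
  moreover have "(Cp z + Cp (- z)) - (Cm z + Cm (- z)) = H_density w s n z + H_density w s n (- z)"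
    if "z \<in> sphere 0 1" for z
    using jump[of z] jump[of "- z"] that by (simp add: algebra_simps)
  ultimately show thesis by (rule that)
qed

lemma geometric_remainder:
  fixes u z :: complex
  assumes "z \<noteq> 0" "u\<^sup>2 \<noteq> z\<^sup>2"
  shows "1 / (u\<^sup>2 - z\<^sup>2) =
    (\<Sum>k<K. - (1 / z ^ (2 * k + 2)) * u ^ (2 * k)) + u ^ (2 * K) / (z ^ (2 * K) * (u\<^sup>2 - z\<^sup>2))"
proof (induction K)
  case (Suc K)
  have "u ^ (2 * K) / (z ^ (2 * K) * (u\<^sup>2 - z\<^sup>2)) =
    - (1 / z ^ (2 * K + 2)) * u ^ (2 * K) + u ^ (2 * Suc K) / (z ^ (2 * Suc K) * (u\<^sup>2 - z\<^sup>2))"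
    using assms by (simp add: divide_simps) (simp add: algebra_simps power2_eq_square)
  with Suc show ?case by simp
qed simp

lemma circle_mean_bound:
  assumes "continuous_on (sphere 0 1) f" "0 \<le> B" "\<And>\<zeta>. norm \<zeta> = 1 \<Longrightarrow> norm (f \<zeta>) \<le> B"
  shows "norm (circle_mean f) \<le> B"
proof -
  have "norm (circle_mean f) \<le> B / (2 * pi) * (2 * pi * 1)"
    unfolding circle_mean_def
    by (rule has_contour_integral_bound_circlepath[OF has_contour_integral_integral[OF circle_mean_integrable]])
       (use assms in \<open>auto simp: norm_divide norm_mult divide_right_mono\<close>)
  then show ?thesis by simp
qed

text \<open>Expanding the kernel in powers of \<open>\<zeta>/z\<close> makes the coefficients of \<open>H\<^sub>n\<close> pairings, and the first
  \<open>n\<close> of them vanish by orthogonality. The series is stopped after two more terms; the remainder is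
  explicit and bounded uniformly on the circle.\<close>

lemma H_fun_at_infinity:
  assumes w: "continuous_on (sphere 0 1) w"
    and orth: "\<And>k. k < n \<Longrightarrow> pairing w s (S_poly w s n) (int k) = 0"
  obtains \<rho> where "\<rho> \<in> O[at_infinity](\<lambda>z. z powi (-4))"
    "\<forall>\<^sub>F z in at_infinity. H_fun w s n z =
       (- 2 * pairing w s (S_poly w s n) (int n)
        - 2 * pairing w s (S_poly w s n) (int n + 1) / z\<^sup>2 + \<rho> z) / z ^ (2 * n + 2)"
proof -
  \<comment> \<open>the \<open>n\<close> vanishing terms and the two terms that are kept\<close>
  let ?S = "S_poly w s n" and ?K = "n + 2"
  define F where "F \<zeta> = poly ?S (inverse \<zeta>) * w \<zeta> * \<zeta> powi (- s)" for \<zeta>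
  define T where "T z = circle_mean (\<lambda>\<zeta>. F \<zeta> * \<zeta> ^ (2 * ?K) / (\<zeta>\<^sup>2 - z\<^sup>2))" for z
  define \<rho> where "\<rho> z = 2 * T z / z\<^sup>2" for z
  have contF: "continuous_on (sphere 0 1) F"
    unfolding F_def by (intro continuous_intros w) auto
  have nz: "\<zeta>\<^sup>2 \<noteq> z\<^sup>2" if "norm \<zeta> = 1" "norm z \<ge> 2" for \<zeta> z :: complex
    using that by (auto simp: power2_eq_iff)
  have contT: "continuous_on (sphere 0 1) (\<lambda>\<zeta>. F \<zeta> * \<zeta> ^ (2 * ?K) / (\<zeta>\<^sup>2 - z\<^sup>2))" if "norm z \<ge> 2" for z
    using nz[OF _ that] by (intro continuous_intros contF) auto
  obtain M where M: "\<And>\<zeta>. norm \<zeta> = 1 \<Longrightarrow> norm (F \<zeta>) \<le> M" "M \<ge> 0"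
  proof -
    have "bounded (F ` sphere 0 1)"
      by (intro compact_imp_bounded compact_continuous_image contF) auto
    then obtain M where "M > 0" "\<forall>x\<in>F ` sphere 0 1. norm x \<le> M"
      unfolding bounded_pos by blast
    then show ?thesis by (intro that[of M]) auto
  qed
  have T_bound: "norm (T z) \<le> 2 * M / (norm z)\<^sup>2" if z: "norm z \<ge> 2" for z
    unfolding T_def
  proof (intro circle_mean_bound contT z)
    fix \<zeta> :: complex assume \<zeta>: "norm \<zeta> = 1"
    have "(norm z)\<^sup>2 \<ge> 2\<^sup>2" using z by (intro power_mono) auto
    moreover have "norm (z\<^sup>2) - norm (\<zeta>\<^sup>2) \<le> norm (z\<^sup>2 - \<zeta>\<^sup>2)" by (rule norm_triangle_ineq2)
    ultimately have le: "(norm z)\<^sup>2 / 2 \<le> norm (\<zeta>\<^sup>2 - z\<^sup>2)"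
      using \<zeta> by (simp add: norm_power norm_minus_commute)
    have pos: "0 < (norm z)\<^sup>2 / 2" using z by auto
    have "norm (F \<zeta> * \<zeta> ^ (2 * ?K) / (\<zeta>\<^sup>2 - z\<^sup>2)) = norm (F \<zeta>) / norm (\<zeta>\<^sup>2 - z\<^sup>2)"
      using \<zeta> by (simp add: norm_mult norm_divide norm_power)
    also have "\<dots> \<le> M / ((norm z)\<^sup>2 / 2)"
      using M(1)[OF \<zeta>] M(2) le pos by (intro frac_le) auto
    finally show "norm (F \<zeta> * \<zeta> ^ (2 * ?K) / (\<zeta>\<^sup>2 - z\<^sup>2)) \<le> 2 * M / (norm z)\<^sup>2"
      by (simp add: field_simps)
  qed (use M in auto)
  have "\<rho> \<in> O[at_infinity](\<lambda>z. z powi (-4))"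
  proof (rule bigoI)
    have "norm (\<rho> z) \<le> 4 * M * norm (z powi (-4))" if z: "2 \<le> norm z" for z
    proof -
      have "norm (\<rho> z) = 2 * norm (T z) / (norm z)\<^sup>2"
        by (simp add: \<rho>_def norm_divide norm_mult norm_power)
      also have "\<dots> \<le> 2 * (2 * M / (norm z)\<^sup>2) / (norm z)\<^sup>2"
        by (intro divide_right_mono mult_left_mono T_bound z) auto
      also have "\<dots> = 4 * M * norm (z powi (-4))"
        by (simp add: power_int_minus norm_inverse norm_power divide_inverse norm_mult power_numeral_reduce mult_ac)
      finally show ?thesis .
    qed
    then show "\<forall>\<^sub>F z in at_infinity. norm (\<rho> z) \<le> 4 * M * norm (z powi (-4))"
      unfolding eventually_at_infinity by blast
  qed
  moreover have "H_fun w s n z =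
       (- 2 * pairing w s ?S (int n) - 2 * pairing w s ?S (int n + 1) / z\<^sup>2 + \<rho> z) / z ^ (2 * n + 2)"
    if z: "norm z \<ge> 2" for z
  proof -
    have "z \<noteq> 0" using z by auto
    have mom: "circle_mean (\<lambda>\<zeta>. F \<zeta> * \<zeta> ^ (2 * k)) = pairing w s ?S (int k)" for k
      unfolding circle_mean_pairing[OF w, symmetric]
    proof (rule circle_mean_cong)
      fix \<zeta> :: complex assume "norm \<zeta> = 1"
      then have "\<zeta> powi (- s) * \<zeta> ^ (2 * k) = \<zeta> powi (2 * int k - s)"
        by (subst power_int_of_nat[symmetric], subst power_int_add[symmetric]) (auto simp: algebra_simps)
      then show "F \<zeta> * \<zeta> ^ (2 * k) = poly ?S (inverse \<zeta>) * \<zeta> powi (2 * int k - s) * w \<zeta>"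
        unfolding F_def by (metis mult.assoc mult.commute)
    qed
    \<comment> \<open>The summand \<open>k = ?K\<close> stands for the remainder, so that linearity is used only once.\<close>
    have "circle_mean (H_integrand w s n z) = circle_mean (\<lambda>\<zeta>. \<Sum>k\<in>{..?K}.
        (if k < ?K then - (1 / z ^ (2 * k + 2)) else 1 / z ^ (2 * ?K)) *
        (if k < ?K then F \<zeta> * \<zeta> ^ (2 * k) else F \<zeta> * \<zeta> ^ (2 * ?K) / (\<zeta>\<^sup>2 - z\<^sup>2)))"
    proof (rule circle_mean_cong)
      fix \<zeta> :: complex assume \<zeta>: "norm \<zeta> = 1"
      have "H_integrand w s n z \<zeta> = F \<zeta> * (1 / (\<zeta>\<^sup>2 - z\<^sup>2))"
        by (simp add: H_integrand_def F_def)
      also have "\<dots> = (\<Sum>k<?K. - (1 / z ^ (2 * k + 2)) * (F \<zeta> * \<zeta> ^ (2 * k)))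
          + 1 / z ^ (2 * ?K) * (F \<zeta> * \<zeta> ^ (2 * ?K) / (\<zeta>\<^sup>2 - z\<^sup>2))"
        unfolding geometric_remainder[OF \<open>z \<noteq> 0\<close> nz[OF \<zeta> z], of ?K] distrib_left sum_distrib_left
        by (intro arg_cong2[where f = "(+)"] sum.cong) (auto simp: mult_ac)
      also have "\<dots> = (\<Sum>k\<in>{..?K}.
        (if k < ?K then - (1 / z ^ (2 * k + 2)) else 1 / z ^ (2 * ?K)) *
        (if k < ?K then F \<zeta> * \<zeta> ^ (2 * k) else F \<zeta> * \<zeta> ^ (2 * ?K) / (\<zeta>\<^sup>2 - z\<^sup>2)))"
        by (subst lessThan_Suc_atMost[symmetric], subst sum.lessThan_Suc) simp
      finally show "H_integrand w s n z \<zeta> = \<dots>" .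
    qed
    also have "\<dots> = (\<Sum>k\<in>{..?K}.
        (if k < ?K then - (1 / z ^ (2 * k + 2)) else 1 / z ^ (2 * ?K)) *
        circle_mean (\<lambda>\<zeta>. if k < ?K then F \<zeta> * \<zeta> ^ (2 * k) else F \<zeta> * \<zeta> ^ (2 * ?K) / (\<zeta>\<^sup>2 - z\<^sup>2)))"
    proof (rule circle_mean_linear)
      fix k
      show "continuous_on (sphere 0 1)
        (\<lambda>\<zeta>. if k < ?K then F \<zeta> * \<zeta> ^ (2 * k) else F \<zeta> * \<zeta> ^ (2 * ?K) / (\<zeta>\<^sup>2 - z\<^sup>2))"
        by (cases "k < ?K") (simp_all only: if_True if_False, intro continuous_intros contF, rule contT[OF z])
    qed auto
    also have "\<dots> = (\<Sum>k<?K. - (1 / z ^ (2 * k + 2)) * pairing w s ?S (int k)) + 1 / z ^ (2 * ?K) * T z"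
      by (subst lessThan_Suc_atMost[symmetric], subst sum.lessThan_Suc) (simp add: mom T_def)
    also have "(\<Sum>k<?K. - (1 / z ^ (2 * k + 2)) * pairing w s ?S (int k)) =
        - (1 / z ^ (2 * n + 2)) * pairing w s ?S (int n)
        - (1 / z ^ (2 * n + 4)) * pairing w s ?S (int n + 1)"
      using orth by (simp add: numeral_eq_Suc add.commute)
    finally have mean: "circle_mean (H_integrand w s n z) =
        - (1 / z ^ (2 * n + 2)) * pairing w s ?S (int n)
        - (1 / z ^ (2 * n + 4)) * pairing w s ?S (int n + 1) + 1 / z ^ (2 * ?K) * T z" .
    have pow: "z ^ (2 * n + 4) = z ^ (2 * n + 2) * z\<^sup>2" "z ^ (2 * ?K) = z ^ (2 * n + 2) * z\<^sup>2"
      by (simp_all add: power_add power2_eq_square power4_eq_xxxx)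
    have alg: "2 * (- (1 / p) * a - (1 / (p * y)) * b + 1 / (p * y) * t) =
        (- 2 * a - 2 * b / y + 2 * t / y) / p" for p y a b t :: complex
      by (simp add: divide_inverse algebra_simps)
    show ?thesis
      unfolding H_fun_def \<rho>_def mean pow alg ..
  qed
  then have "\<forall>\<^sub>F z in at_infinity. H_fun w s n z =
       (- 2 * pairing w s ?S (int n) - 2 * pairing w s ?S (int n + 1) / z\<^sup>2 + \<rho> z) / z ^ (2 * n + 2)"
    unfolding eventually_at_infinity by blast
  ultimately show thesis by (rule that)
qed

section \<open>Odd parts and expansions of polynomials\<close>

text \<open>The division of the odd part of \<open>p\<close> by its argument, carried out on coefficients.\<close>

definition odd_part_poly :: "complex poly \<Rightarrow> complex poly" where
  "odd_part_poly p = [:1 / 2:] * poly_shift 1 (p - p \<circ>\<^sub>p [:0, -1:])"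

lemma coeff_odd_part_poly:
  "coeff (odd_part_poly p) i = (if even i then coeff p (Suc i) else 0)"
  by (simp add: odd_part_poly_def coeff_poly_shift coeff_pcompose_linear)

lemma poly_odd_part_poly: "poly (odd_part_poly p) z = odd_quotient p z"
proof (cases "z = 0")
  case True
  then show ?thesis
    by (simp add: odd_quotient_def poly_0_coeff_0 coeff_odd_part_poly)
next
  case False
  define r where "r = p - p \<circ>\<^sub>p [:0, -1:]"
  have "r = pCons 0 (poly_shift 1 r)"
    by (rule poly_eqI) (auto simp: r_def coeff_poly_shift coeff_pCons coeff_pcompose_linear split: nat.splits)
  then have "poly r z = z * poly (poly_shift 1 r) z"
    by (metis poly_pCons add_0)
  moreover have "poly r z = poly p z - poly p (- z)"
    by (simp add: r_def poly_pcompose)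
  ultimately show ?thesis
    using False by (simp add: odd_part_poly_def odd_quotient_def flip: r_def)
qed

lemma deriv_poly_funpow: "(deriv ^^ j) (poly p) = poly ((pderiv ^^ j) p)" for p :: "complex poly"
proof (induction j arbitrary: p)
  case (Suc j)
  have "deriv (poly p) = poly (pderiv p)"
    by (rule ext) (auto intro: DERIV_imp_deriv poly_DERIV)
  then show ?case
    by (simp add: funpow_Suc_right Suc del: funpow.simps)
qed simp

lemma taylor_coeff_poly: "1 / fact j * (deriv ^^ j) (poly p) 0 = coeff p j" for p :: "complex poly"
  by (simp add: deriv_poly_funpow poly_0_coeff_0 coeff_higher_pderiv flip: pochhammer_fact)

lemma poly_recip_bounded:
  fixes p :: "complex poly"
  shows "(\<lambda>z. poly p (1 / z)) \<in> O[at_infinity](\<lambda>_. 1)"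
proof (rule bigoI_tendsto)
  have "((\<lambda>z::complex. 1 / z) \<longlongrightarrow> 0) at_infinity"
    unfolding inverse_eq_divide[symmetric] by (rule tendsto_inverse_0)
  from tendsto_poly[OF this]
  show "((\<lambda>z. poly p (1 / z) / 1) \<longlongrightarrow> poly p 0) at_infinity" by simp
qed auto

text \<open>Taylor's formula for \<open>p\<close> at \<open>0\<close>, read in the variable \<open>1/z\<close>.\<close>

lemma poly_recip_expansion:
  fixes p :: "complex poly"
  shows "\<exists>\<rho>. \<rho> \<in> O[at_infinity](\<lambda>z. z powi (-3)) \<and>
    (\<forall>z. z \<noteq> 0 \<longrightarrow> poly p (1 / z) = coeff p 0 + coeff p 1 / z + coeff p 2 / z\<^sup>2 + \<rho> z)"
proof (intro exI conjI allI impI)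
  let ?r = "\<lambda>z. z powi (-3) * poly (poly_shift 3 p) (1 / z)"
  show "?r \<in> O[at_infinity](\<lambda>z. z powi (-3))"
    using landau_o.big.mult[OF landau_o.big_refl poly_recip_bounded] by simp
  fix z :: complex assume "z \<noteq> 0"
  have "p = pCons (coeff p 0) (pCons (coeff p 1) (pCons (coeff p 2) (poly_shift 3 p)))"
    by (rule poly_eqI) (auto simp: coeff_pCons coeff_poly_shift numeral_eq_Suc split: nat.splits)
  then have "poly p (1 / z) = poly (pCons (coeff p 0) (pCons (coeff p 1) (pCons (coeff p 2) (poly_shift 3 p)))) (1 / z)"
    by simp
  also have "\<dots> = coeff p 0 + coeff p 1 / z + coeff p 2 / z\<^sup>2 + ?r z"
    using \<open>z \<noteq> 0\<close>
    by (simp add: divide_inverse power_int_minus algebra_simps power2_eq_square power3_eq_cube)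
  finally show "poly p (1 / z) = coeff p 0 + coeff p 1 / z + coeff p 2 / z\<^sup>2 + ?r z" .
qed

lemma powi_bigo_powi:
  assumes "k \<le> l"
  shows "(\<lambda>z. z powi k) \<in> O[at_infinity](\<lambda>z::complex. z powi l)"
proof (rule bigoI)
  show "\<forall>\<^sub>F z::complex in at_infinity. norm (z powi k) \<le> 1 * norm (z powi l)"
    unfolding eventually_at_infinity
    by (intro exI[of _ 1]) (auto simp: norm_power_int intro!: power_int_increasing assms)
qed

section \<open>Matrices of size three\<close>

lemma matrix_inv_left_inverse:
  fixes A :: "complex^'n^'n"
  assumes "invertible A"
  shows "matrix_inv A ** A = Finite_Cartesian_Product.mat 1" "invertible (matrix_inv A)"
proof -
  have *: "A ** matrix_inv A = Finite_Cartesian_Product.mat 1 \<and> matrix_inv A ** A = Finite_Cartesian_Product.mat 1"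
    using assms unfolding invertible_def matrix_inv_def by (rule someI_ex)
  then show "matrix_inv A ** A = Finite_Cartesian_Product.mat 1" by simp
  show "invertible (matrix_inv A)" using * unfolding invertible_def by blast
qed

lemma rank_invertible:
  fixes A :: "complex^'n^'n"
  assumes "invertible A"
  shows "rank A = CARD('n)"
proof -
  have "vec.span (Finite_Cartesian_Product.rows A) = UNIV"
    using assms matrix_left_invertible_span_rows_gen[of A] by (auto simp: invertible_def)
  then have "vec.dim (Finite_Cartesian_Product.rows A) = vec.dim (UNIV :: (complex^'n) set)"
    by (metis vec.dim_span)
  then show ?thesis
    by (simp only: row_rank_def_gen vec_dim_card)
qed

text \<open>Left multiplication acts on each column, and an invertible factor keeps the rank. So the ranks
  can be computed before the normalisation by the inverse of \<open>B_mat\<close>.\<close>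

lemma rank_of_columns_mult:
  assumes "invertible A" "Determinants.det (of_columns a b c) \<noteq> 0"
  shows "rank (of_columns (A *v a) (A *v b) (A *v c)) = 3"
proof -
  have "of_columns (A *v a) (A *v b) (A *v c) = A ** of_columns a b c"
    unfolding Finite_Cartesian_Product.vec_eq_iff forall_3
    by (simp add: of_columns_def transpose_def matrix_matrix_mult_def matrix_vector_mult_def sum_3 vector_3)
  then show ?thesis
    using assms rank_invertible[OF invertible_mult, of A "of_columns a b c"]
    by (simp add: invertible_det_nz)
qed

lemma det_of_columns:
  "Determinants.det (of_columns a b c) =
     a$1 * (b$2 * c$3 - b$3 * c$2) - a$2 * (b$1 * c$3 - b$3 * c$1) + a$3 * (b$1 * c$2 - b$2 * c$1)"
  for a b c :: "complex^3"
  by (simp add: of_columns_def Finite_Cartesian_Product.transpose_def Determinants.det_3 vector_3 algebra_simps)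

lemma mult_asym_mat:
  fixes M :: "complex^3^3"
  shows "(M ** asym_mat m z) $ i $ j = M $ i $ j * asym_mat m z $ j $ j"
  using exhaust_3[of j]
  by (auto simp: asym_mat_def matrix_matrix_mult_def sum_3 vector_3)

section \<open>The matrix \<open>X\<^sub>m\<close>\<close>

text \<open>Indexing the degrees by the rows allows all statements below to treat the three rows at once.\<close>

definition row_degree :: "nat \<Rightarrow> 3 \<Rightarrow> nat" where
  "row_degree m i = (vector [2 * m, 2 * m - 1, 2 * m - 2] :: nat^3) $ i"

lemma row_degree_simps [simp]:
  "row_degree m 1 = 2 * m" "row_degree m 2 = 2 * m - 1" "row_degree m 3 = 2 * m - 2"
  by (simp_all add: row_degree_def vector_3)

locale nondegenerate_symbol =
  fixes w :: "complex \<Rightarrow> complex" and m :: nat and s :: int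
  assumes plemelj: "plemelj_symbol w"
    and m_ge_1: "m \<ge> 1"
    and E_det_nz: "\<And>i. E_det w s (row_degree m i) \<noteq> 0"
    and minor_nz: "E_det w (s + 1) (2*m) * Ehat_det w s (2*m - 1)
            - E_det w (s + 1) (2*m - 1) * Ehat_det w s (2*m) \<noteq> 0"
begin

definition S :: "3 \<Rightarrow> complex poly" where "S i = S_poly w s (row_degree m i)"

lemma cont_w: "continuous_on (sphere 0 1) w"
  using plemelj by (simp add: plemelj_symbol_def)

lemma degree_S: "degree (S_poly w s (row_degree m i)) = row_degree m i"
  by (rule degree_S_poly[OF cont_w E_det_nz])

lemma g_nz: "g_const w s (2 * m - 1) \<noteq> 0" "g_const w s (2 * m - 2) \<noteq> 0"
proof -
  have "2 * m - 1 + 1 = 2 * m" "2 * m - 2 + 1 = 2 * m - 1" using m_ge_1 by auto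
  then show "g_const w s (2 * m - 1) \<noteq> 0" "g_const w s (2 * m - 2) \<noteq> 0"
    unfolding g_const_def
    using E_det_nz[of 1] E_det_nz[of 2] E_det_nz[of 3] by simp_all
qed

lemma B_mat_column:
  "B_mat w m s $ i $ 1 = coeff (S i) 0"
  "B_mat w m s $ i $ 2 = coeff (S i) 1"
  "B_mat w m s $ i $ 3 = (if i = 3 then - 2 * g_const w s (2 * m - 2) else 0)"
  using exhaust_3[of i]
  by (auto simp: B_mat_def vector_3 poly_0_coeff_0 coeff_pderiv S_def)

text \<open>The third column of \<open>B_mat\<close> reduces the determinant to the upper left minor, which consists of
  the two lowest coefficients of \<open>S 1\<close> and \<open>S 2\<close>; the signs are those of the parities of \<open>2m\<close> and
  \<open>2m - 1\<close>.\<close>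

lemma det_B_mat:
  "Determinants.det (B_mat w m s) = - 2 * g_const w s (2 * m - 2) *
    ((E_det w (s + 1) (2*m) * Ehat_det w s (2*m - 1) - E_det w (s + 1) (2*m - 1) * Ehat_det w s (2*m))
          / (E_det w s (2*m) * E_det w s (2*m - 1)))"
proof -
  have "even (2 * m)" "odd (2 * m - 1)" "2 * m \<ge> 1" "2 * m - 1 \<ge> 1" using m_ge_1 by auto
  then have c: "coeff (S 1) 0 = E_det w (s + 1) (2 * m) / E_det w s (2 * m)"
    "coeff (S 1) 1 = - Ehat_det w s (2 * m) / E_det w s (2 * m)"
    "coeff (S 2) 0 = - E_det w (s + 1) (2 * m - 1) / E_det w s (2 * m - 1)"
    "coeff (S 2) 1 = Ehat_det w s (2 * m - 1) / E_det w s (2 * m - 1)"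
    using E_det_nz[of 1] E_det_nz[of 2] unfolding S_def
    by (simp_all add: coeff_S_poly_0 coeff_S_poly_1[unfolded One_nat_def] cont_w)
  have "Determinants.det (B_mat w m s) =
      - 2 * g_const w s (2 * m - 2) * (coeff (S 1) 0 * coeff (S 2) 1 - coeff (S 1) 1 * coeff (S 2) 0)"
    by (simp add: Determinants.det_3 B_mat_column algebra_simps)
  moreover have "a / b * (c / d) - - e / b * (- f / d) = (a * c - f * e) / (b * d)" for a b c d e f :: complex
    by (simp add: diff_divide_distrib mult.commute)
  then have "coeff (S 1) 0 * coeff (S 2) 1 - coeff (S 1) 1 * coeff (S 2) 0 =
    (E_det w (s + 1) (2*m) * Ehat_det w s (2*m - 1) - E_det w (s + 1) (2*m - 1) * Ehat_det w s (2*m))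
          / (E_det w s (2*m) * E_det w s (2*m - 1))"
    unfolding c .
  ultimately show ?thesis by simp
qed

lemma invertible_B_mat: "invertible (B_mat w m s)"
  using det_B_mat minor_nz g_nz E_det_nz[of 1] E_det_nz[of 2] by (simp add: invertible_det_nz)

abbreviation Binv :: "complex^3^3" where "Binv \<equiv> matrix_inv (B_mat w m s)"

text \<open>The factors \<open>1\<close>, \<open>z\<close>, \<open>z\<^sup>2\<close> of the three rows compensate the decreasing degrees.\<close>

lemma X_raw_column1:
  assumes "z \<noteq> 0"
  shows "X_raw w m s z $ i $ 1 = z ^ (2 * m) * poly (S i) (1 / z)"
proof -
  have *: "poly (S_star w s (row_degree m i)) z = z ^ row_degree m i * poly (S i) (1 / z)" for i
    using assms by (simp add: S_star_def poly_reflect_poly_nz degree_S S_def inverse_eq_divide)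
  have "z * z ^ (2 * m - 1) = z ^ (2 * m)" "z\<^sup>2 * z ^ (2 * m - 2) = z ^ (2 * m)"
    using m_ge_1 by (cases m; simp add: power2_eq_square)+
  then show ?thesis
    using *[of 1] *[of 2] *[of 3] exhaust_3[of i]
    by (auto simp: X_raw_def vector_3 simp flip: mult.assoc)
qed

text \<open>Passing from \<open>S i\<close> to its reciprocal polynomial keeps parity in the even degrees and exchanges
  it in the odd degree \<open>2m - 1\<close>. This is why the second row contains an even part and the others
  odd parts.\<close>

lemma X_raw_column2:
  assumes "z \<noteq> 0"
  shows "X_raw w m s z $ i $ 2 = z ^ (2 * m - 2) * odd_quotient (S i) (1 / z)"
proof -
  have *: "poly (S_star w s (row_degree m i)) x = x ^ row_degree m i * poly (S i) (1 / x)" if "x \<noteq> 0" for x i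
    using that by (simp add: S_star_def poly_reflect_poly_nz degree_S S_def inverse_eq_divide)
  have pow: "z ^ (2 * m) = z\<^sup>2 * z ^ (2 * m - 2)" "z ^ (2 * m - 1) = z * z ^ (2 * m - 2)"
    "(- z) ^ (2 * m) = z\<^sup>2 * z ^ (2 * m - 2)" "(- z) ^ (2 * m - 1) = - z * z ^ (2 * m - 2)"
    "(- z) ^ (2 * m - 2) = z ^ (2 * m - 2)"
    using m_ge_1 by (cases m; simp add: power2_eq_square)+
  have "- z \<noteq> 0" using assms by simp
  note vals = this[THEN *, of 1, unfolded row_degree_simps pow] assms[THEN *, of 1, unfolded row_degree_simps pow]
    this[THEN *, of 2, unfolded row_degree_simps pow] assms[THEN *, of 2, unfolded row_degree_simps pow]
    this[THEN *, of 3, unfolded row_degree_simps pow] assms[THEN *, of 3, unfolded row_degree_simps pow]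
  show ?thesis
    unfolding X_raw_def odd_quotient_def vals
    using exhaust_3[of i] assms
    by (auto simp: vector_3 divide_simps power2_eq_square) (simp_all add: algebra_simps)
qed

lemma X_raw_column3: "X_raw w m s z $ i $ 3 = H_fun w s (row_degree m i) z"
  using exhaust_3[of i] by (auto simp: X_raw_def vector_3)

text \<open>The entries of the first column as polynomials, including the value at \<open>0\<close>, where the Taylor
  coefficients are taken.\<close>

definition column1_poly :: "3 \<Rightarrow> complex poly" where
  "column1_poly i = monom 1 (2 * m - row_degree m i) * S_star w s (row_degree m i)"

lemma poly_column1_poly: "poly (column1_poly i) z = X_raw w m s z $ i $ 1"
proof -
  have "2 * m - (2 * m - 1) = 1" "2 * m - (2 * m - 2) = 2" using m_ge_1 by auto
  then show ?thesis
    using exhaust_3[of i] by (auto simp: column1_poly_def X_raw_def vector_3 poly_monom)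
qed

lemma X_raw_column2_holomorphic: "(\<lambda>z. X_raw w m s z $ i $ 2) holomorphic_on UNIV"
  using exhaust_3[of i]
  by (auto simp: X_raw_def vector_3 simp flip: poly_odd_part_poly intro!: holomorphic_intros)

lemma X_raw_column12_holomorphic:
  assumes "j \<noteq> 3"
  shows "(\<lambda>z. X_raw w m s z $ i $ j) holomorphic_on UNIV"
  using exhaust_3[of j] assms X_raw_column2_holomorphic
  by (auto simp flip: poly_column1_poly intro!: holomorphic_intros)

lemma X_mat_holomorphic: "(\<lambda>z. X_mat w m s z $ i $ j) holomorphic_on - sphere 0 1"
proof -
  have "(\<lambda>z. X_raw w m s z $ i $ j) holomorphic_on - sphere 0 1" for i
  proof (cases "j = 3")
    case True
    then show ?thesis
      using H_fun_holomorphic[OF cont_w degree_S] by (simp add: X_raw_column3)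
  next
    case False
    then show ?thesis
      using X_raw_column12_holomorphic by (blast intro: holomorphic_on_subset)
  qed
  then show ?thesis
    unfolding X_mat_def matrix_matrix_mult_def by (auto intro!: holomorphic_intros)
qed

text \<open>Put \<open>a = S\<^sub>i(1/z)\<close>, \<open>b = S\<^sub>i(-1/z)\<close> and \<open>\<sigma> = (-1)\<^sup>s\<close>. Up to the factor \<open>z\<^bsup>-s-2\<^esup>\<close>, the right-hand side
  is \<open>(w(z) + \<sigma> w(-z)) a - \<sigma> w(-z) (a - b) = w(z) a + \<sigma> w(-z) b\<close>.\<close>

lemma H_density_pair:
  assumes "z \<in> sphere 0 1"
  shows "H_density w s (row_degree m i) z + H_density w s (row_degree m i) (- z) =
     k1 w m s z * X_raw w m s z $ i $ 1 + k2 w m s z * X_raw w m s z $ i $ 2"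
proof -
  have z: "z \<noteq> 0" using assms by auto
  define \<sigma> :: complex where "\<sigma> = (- 1) powi s"
  define q where "q = z powi (- s - 2)"
  have sig: "(- 1 :: complex) powi (s + 1) = - \<sigma>"
    by (simp add: \<sigma>_def power_int_add)
  have minus: "(- z) powi (- s - 2) = \<sigma> * q"
    by (simp add: \<sigma>_def q_def power_int_minus_left power_int_minus_one_minus)
  have k1: "z powi (- 2 * int m - s - 2) * z ^ (2 * m) = q"
    using z by (simp add: q_def flip: power_int_of_nat power_int_add)
  have k2: "z powi (- 2 * int m - s - 1) * z ^ (2 * m - 2) * z = q"
  proof -
    have "z ^ (2 * m - 2) * z = z powi (2 * int m - 1)"
    proof -
      have "2 * int m - 1 = int (2 * m - 1)" using m_ge_1 by (simp add: of_nat_diff)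
      moreover have "z ^ (2 * m - 2) * z = z ^ (2 * m - 1)" using m_ge_1 by (cases m) simp_all
      ultimately show ?thesis by (simp only: power_int_of_nat)
    qed
    then show ?thesis
      using z by (simp add: q_def mult.assoc flip: power_int_add)
  qed
  let ?a = "poly (S i) (1 / z)" and ?b = "poly (S i) (- (1 / z))"
  have "k1 w m s z * X_raw w m s z $ i $ 1 = q * (w z + \<sigma> * w (- z)) * ?a"
    by (simp add: k1_def X_raw_column1[OF z] \<sigma>_def flip: k1)
  moreover have "k2 w m s z * X_raw w m s z $ i $ 2 = - \<sigma> * q * w (- z) * (?a - ?b)"
  proof -
    have "odd_quotient (S i) (1 / z) = z / 2 * (?a - ?b)"
      using z by (simp add: odd_quotient_def)
    then show ?thesis
      unfolding k2_def X_raw_column2[OF z] sig k2[symmetric] by (simp add: mult_ac)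
  qed
  moreover have "H_density w s (row_degree m i) z + H_density w s (row_degree m i) (- z) =
      ?a * w z * q + ?b * w (- z) * (\<sigma> * q)"
    using z by (simp add: H_density_eq degree_S minus q_def S_def inverse_eq_divide)
  ultimately show ?thesis by (simp add: algebra_simps)
qed

lemma X_mat_jump:
  "\<exists>Xp Xm. boundary_values (X_mat w m s) Xp Xm \<and> (\<forall>z\<in>sphere 0 1. Xp z = Xm z ** jump_mat w m s z)"
proof -
  have "\<exists>Hp Hm. boundary_values (H_fun w s (row_degree m i)) Hp Hm \<and>
      (\<forall>z\<in>sphere 0 1. Hp z - Hm z = H_density w s (row_degree m i) z + H_density w s (row_degree m i) (- z))" for i
    using H_fun_jump[OF plemelj degree_S] by metis
  then obtain Hp Hm where H: "\<And>i. boundary_values (H_fun w s (row_degree m i)) (Hp i) (Hm i)"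
    "\<And>i z. z \<in> sphere 0 1 \<Longrightarrow>
      Hp i z - Hm i z = H_density w s (row_degree m i) z + H_density w s (row_degree m i) (- z)"
    by metis
  \<comment> \<open>Only the third column jumps: the other two columns are entire functions.\<close>
  define R where "R f z = (\<chi> i j. if j = 3 then f i z else X_raw w m s z $ i $ j)"
    for f :: "3 \<Rightarrow> complex \<Rightarrow> complex" and z
  have "boundary_values (\<lambda>z. X_raw w m s z $ i $ j) (\<lambda>z. R Hp z $ i $ j) (\<lambda>z. R Hm z $ i $ j)" for i j
  proof (cases "j = 3")
    case True
    then show ?thesis using H(1)[of i] by (simp add: R_def X_raw_column3)
  next
    case False
    then show ?thesis
      using boundary_values_continuous[OF holomorphic_on_imp_continuous_on[OF X_raw_column12_holomorphic[OF False]]]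
      by (simp add: R_def)
  qed
  then have "boundary_values (X_mat w m s) (\<lambda>z. Binv ** R Hp z) (\<lambda>z. Binv ** R Hm z)"
    unfolding X_mat_def[abs_def] by (rule boundary_values_matrix_mult)
  moreover have "Binv ** R Hp z = (Binv ** R Hm z) ** jump_mat w m s z" if "z \<in> sphere 0 1" for z
  proof -
    have "R Hp z $ i $ j = (R Hm z ** jump_mat w m s z) $ i $ j" for i j
      using exhaust_3[of j] H(2)[OF that, of i] H_density_pair[OF that, of i]
      by (auto simp: R_def jump_mat_def matrix_matrix_mult_def sum_3 vector_3 algebra_simps)
    then have "R Hp z = R Hm z ** jump_mat w m s z" by (simp add: Finite_Cartesian_Product.vec_eq_iff)
    then show ?thesis by (simp add: matrix_mul_assoc)
  qed
  ultimately show ?thesis by blast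
qed

text \<open>The pairing that gives the second term of the expansion of \<open>H\<close> at infinity.\<close>

definition next_pairing :: "3 \<Rightarrow> complex" where
  "next_pairing i = pairing w s (S i) (int (row_degree m i) + 1)"

text \<open>The coefficient of \<open>z\<^bsup>-2\<^esup>\<close> in the third column of \<open>X_raw\<close>, normalised by \<open>z\<^bsup>4m-2\<^esup>\<close>.\<close>

definition H_subleading :: "complex^3" where
  "H_subleading = vector [0, - 2 * g_const w s (2 * m - 1), - 2 * next_pairing 3]"

lemma pairing_S:
  "k < row_degree m i \<Longrightarrow> pairing w s (S i) (int k) = 0"
  "pairing w s (S i) (int (row_degree m i)) = g_const w s (row_degree m i)"
  unfolding S_def by (simp_all add: pairing_S_poly_less pairing_S_poly_eq cont_w E_det_nz)

lemma column1_expansion: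
  "\<exists>\<rho>. \<rho> \<in> O[at_infinity](\<lambda>z. z powi (-3)) \<and> (\<forall>z. z \<noteq> 0 \<longrightarrow> X_raw w m s z $ i $ 1 =
       (coeff (S i) 0 + coeff (S i) 1 / z + coeff (S i) 2 / z\<^sup>2 + \<rho> z) * z ^ (2 * m))"
proof -
  obtain \<rho> where "\<rho> \<in> O[at_infinity](\<lambda>z. z powi (-3))"
    "\<forall>z. z \<noteq> 0 \<longrightarrow> poly (S i) (1 / z) =
       coeff (S i) 0 + coeff (S i) 1 / z + coeff (S i) 2 / z\<^sup>2 + \<rho> z"
    using poly_recip_expansion[of "S i"] by (elim exE conjE) (rule that)
  then show ?thesis
    by (intro exI[of _ \<rho>]) (simp add: X_raw_column1)
qed

text \<open>The term with \<open>1/z\<close> is absent because the odd part divided by its argument is even.\<close>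

lemma column2_expansion:
  "\<exists>\<rho>. \<rho> \<in> O[at_infinity](\<lambda>z. z powi (-3)) \<and> (\<forall>z. z \<noteq> 0 \<longrightarrow> X_raw w m s z $ i $ 2 =
       (coeff (S i) 1 + coeff (S i) 3 / z\<^sup>2 + \<rho> z) * z ^ (2 * m - 2))"
proof -
  obtain \<rho> where \<rho>: "\<rho> \<in> O[at_infinity](\<lambda>z. z powi (-3))"
    and eq: "\<forall>z. z \<noteq> 0 \<longrightarrow> poly (odd_part_poly (S i)) (1 / z) = coeff (odd_part_poly (S i)) 0
      + coeff (odd_part_poly (S i)) 1 / z + coeff (odd_part_poly (S i)) 2 / z\<^sup>2 + \<rho> z"
    using poly_recip_expansion[of "odd_part_poly (S i)"] by (elim exE conjE) (rule that)
  have "X_raw w m s z $ i $ 2 = (coeff (S i) 1 + coeff (S i) 3 / z\<^sup>2 + \<rho> z) * z ^ (2 * m - 2)"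
    if "z \<noteq> 0" for z
    using eq that
    by (simp add: X_raw_column2 poly_odd_part_poly coeff_odd_part_poly numeral_3_eq_3)
  with \<rho> show ?thesis by blast
qed

text \<open>Relative to \<open>z\<^bsup>-4m+2\<^esup>\<close>, the leading power \<open>z\<^bsup>-2n-2\<^esup>\<close> of \<open>H\<^sub>n\<close> is \<open>z\<^bsup>-4\<^esup>\<close>, \<open>z\<^bsup>-2\<^esup>\<close> and \<open>1\<close> in the three
  rows. So the first row belongs to the error term, the second contributes its leading coefficient
  at order \<open>z\<^bsup>-2\<^esup>\<close>, and the third its first two coefficients.\<close>

lemma column3_expansion:
  "\<exists>\<rho>. \<rho> \<in> O[at_infinity](\<lambda>z. z powi (-4)) \<and> (\<forall>\<^sub>F z in at_infinity. X_raw w m s z $ i $ 3 =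
       (B_mat w m s $ i $ 3
        + H_subleading $ i / z\<^sup>2 + \<rho> z)
       * z powi (- 4 * int m + 2))"
proof -
  let ?d = "row_degree m i"
  let ?g = "g_const w s ?d"
  obtain \<rho> where \<rho>: "\<rho> \<in> O[at_infinity](\<lambda>z. z powi (-4))"
    and eq: "\<forall>\<^sub>F z in at_infinity. H_fun w s ?d z =
       (- 2 * ?g - 2 * next_pairing i / z\<^sup>2 + \<rho> z) / z ^ (2 * ?d + 2)"
    using H_fun_at_infinity[OF cont_w pairing_S(1)[of _ i, unfolded S_def]]
    unfolding next_pairing_def pairing_S(2)[of i, unfolded S_def] S_def by blast
  have c_small: "(\<lambda>z. c / z\<^sup>2) \<in> O[at_infinity](\<lambda>z::complex. z powi (-2))" for c
    by (simp add: power_int_minus divide_inverse)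
  have nz: "\<forall>\<^sub>F z::complex in at_infinity. z \<noteq> 0"
    unfolding eventually_at_infinity by (intro exI[of _ 1]) auto
  have prod: "(\<lambda>z. z powi k * f z) \<in> O[at_infinity](\<lambda>z::complex. z powi (k + l))"
    if "f \<in> O[at_infinity](\<lambda>z. z powi l)" for f k l
  proof -
    have "(\<lambda>z. z powi k * f z) \<in> O[at_infinity](\<lambda>z. z powi k * z powi l)"
      by (intro landau_o.big.mult that) auto
    also have "\<forall>\<^sub>F z::complex in at_infinity. z powi k * z powi l = z powi (k + l)"
      using nz by eventually_elim (simp add: power_int_add)
    then have "O[at_infinity](\<lambda>z::complex. z powi k * z powi l) = O[at_infinity](\<lambda>z. z powi (k + l))"
      by (rule landau_o.big.cong)
    finally show ?thesis .
  qed
  have \<rho>2: "\<rho> \<in> O[at_infinity](\<lambda>z. z powi l)" if "l \<ge> -4" for l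
    using \<rho> powi_bigo_powi[OF that] by (rule landau_o.big_trans)
  consider "i = 1" | "i = 2" | "i = 3" using exhaust_3 by blast
  then show ?thesis
  proof cases
    case 1
    \<comment> \<open>the whole row is of the order of the error term\<close>
    define \<rho>' where "\<rho>' z = z powi (-4) * (- 2 * ?g - 2 * next_pairing i / z\<^sup>2 + \<rho> z)" for z
    have "(\<lambda>z. - 2 * ?g - 2 * next_pairing i / z\<^sup>2 + \<rho> z) \<in> O[at_infinity](\<lambda>z. z powi 0)"
      using landau_o.big_trans[OF c_small[of "2 * next_pairing i"] powi_bigo_powi[of "-2" 0]] \<rho>2[of 0]
      by (intro sum_in_bigo) auto
    from prod[OF this, of "-4"] have "\<rho>' \<in> O[at_infinity](\<lambda>z. z powi (-4))"
      by (simp add: \<rho>'_def[abs_def])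
    moreover have "\<forall>\<^sub>F z in at_infinity. X_raw w m s z $ i $ 3 =
       (B_mat w m s $ i $ 3
        + H_subleading $ i / z\<^sup>2 + \<rho>' z)
       * z powi (- 4 * int m + 2)"
      using eq nz
    proof eventually_elim
      case (elim z)
      have "z powi (-4) * z powi (- 4 * int m + 2) = inverse (z ^ (4 * m + 2))"
        using elim(2) by (simp flip: power_int_add power_int_of_nat power_int_minus)
      then show ?case
        using elim(1) 1 by (simp add: X_raw_column3 B_mat_column H_subleading_def vector_3 \<rho>'_def divide_inverse mult_ac)
    qed
    ultimately show ?thesis by blast
  next
    case 2
    \<comment> \<open>all but the leading coefficient goes into the error term\<close>
    define \<rho>' where "\<rho>' z = z powi (-2) * (- 2 * next_pairing i / z\<^sup>2 + \<rho> z)" for z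
    have "(\<lambda>z. - 2 * next_pairing i / z\<^sup>2 + \<rho> z) \<in> O[at_infinity](\<lambda>z. z powi (-2))"
      using c_small[of "- 2 * next_pairing i"] \<rho>2[of "-2"] by (intro sum_in_bigo) auto
    from prod[OF this, of "-2"] have "\<rho>' \<in> O[at_infinity](\<lambda>z. z powi (-4))"
      by (simp add: \<rho>'_def[abs_def])
    moreover have "\<forall>\<^sub>F z in at_infinity. X_raw w m s z $ i $ 3 =
       (B_mat w m s $ i $ 3
        + H_subleading $ i / z\<^sup>2 + \<rho>' z)
       * z powi (- 4 * int m + 2)"
      using eq nz
    proof eventually_elim
      case (elim z)
      have "z powi (- 4 * int m + 2) = inverse (z ^ (2 * ?d + 2)) * z\<^sup>2"
      proof -
        have e: "- 4 * int m + 2 = - int (2 * ?d + 2) + 2" using 2 m_ge_1 by (simp add: of_nat_diff)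
        have "z powi (- int (2 * ?d + 2) + 2) = z powi (- int (2 * ?d + 2)) * z powi 2"
          using elim(2) by (intro power_int_add) auto
        then show ?thesis
          unfolding e by (simp only: power_int_minus power_int_of_nat power_int_numeral)
      qed
      moreover have "z powi (-2) = inverse (z\<^sup>2)"
        by (simp add: power_int_minus)
      moreover have "X_raw w m s z $ i $ 3 = (- 2 * ?g + - 2 * next_pairing i / z\<^sup>2 + \<rho> z) / z ^ (2 * ?d + 2)"
        using elim(1) by (simp add: X_raw_column3)
      moreover have "(a + b / y + c) / p = (0 + a / y + inverse y * (b / y + c)) * (inverse p * y)"
        if "y \<noteq> 0" for a b c p y :: complex
        using that by (cases "p = 0") (simp_all add: field_simps)
      note this[of "z\<^sup>2" "- 2 * ?g" "- 2 * next_pairing i" "\<rho> z" "z ^ (2 * ?d + 2)"]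
      moreover have "B_mat w m s $ i $ 3 = 0"
        "H_subleading $ i = - 2 * ?g"
        by (simp_all add: 2 B_mat_column H_subleading_def vector_3)
      ultimately show ?case
        using elim(2) unfolding \<rho>'_def by simp
    qed
    ultimately show ?thesis by blast
  next
    case 3
    have "\<forall>\<^sub>F z in at_infinity. X_raw w m s z $ i $ 3 =
       (B_mat w m s $ i $ 3
        + H_subleading $ i / z\<^sup>2 + \<rho> z)
       * z powi (- 4 * int m + 2)"
      using eq nz
    proof eventually_elim
      case (elim z)
      have "- 4 * int m + 2 = - int (2 * ?d + 2)" using 3 m_ge_1 by (simp add: of_nat_diff)
      then have "z powi (- 4 * int m + 2) = inverse (z ^ (2 * ?d + 2))"
        by (simp only: power_int_minus power_int_of_nat)
      then show ?case
        using elim(1) 3 by (simp add: X_raw_column3 B_mat_column H_subleading_def vector_3 divide_inverse)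
    qed
    with \<rho> show ?thesis by blast
  qed
qed

definition phi :: "complex^3" where
  "phi = Binv *v H_subleading"

definition X2 :: "complex^3^3" where
  "X2 = Binv ** (\<chi> i. vector [coeff (S i) 2, coeff (S i) 3,
     H_subleading $ i])"

lemma column_X2: "X2 $ i $ 3 = phi $ i"
  by (simp add: X2_def phi_def matrix_matrix_mult_def matrix_vector_mult_def vector_3)

text \<open>The coefficients of \<open>1\<close> and \<open>1/z\<close> in the normalised \<open>X_raw\<close> are \<open>B_mat\<close> and \<open>B_mat ** X1_inf\<close>: the
  linear coefficient of \<open>S i\<close> occurs in the first column at order \<open>1/z\<close> and in the second column as
  the leading coefficient.\<close>

lemma X_mat_at_infinity:
  "\<exists>R :: complex \<Rightarrow> complex^3^3.
     (\<forall>i j. (\<lambda>z. R z $ i $ j) \<in> O[at_infinity](\<lambda>z. z powi (-3))) \<and>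
     (\<forall>i. (\<lambda>z. R z $ i $ 3) \<in> O[at_infinity](\<lambda>z. z powi (-4))) \<and>
     (\<forall>\<^sub>F z in at_infinity. X_mat w m s z =
        (\<chi> i j. Finite_Cartesian_Product.mat 1 $ i $ j + X1_inf $ i $ j / z
                 + X2 $ i $ j / z\<^sup>2 + R z $ i $ j) ** asym_mat m z)"
proof -
  obtain \<rho>1 where \<rho>1: "\<forall>i. \<rho>1 i \<in> O[at_infinity](\<lambda>z. z powi (-3)) \<and>
      (\<forall>z. z \<noteq> 0 \<longrightarrow> X_raw w m s z $ i $ 1 =
       (coeff (S i) 0 + coeff (S i) 1 / z + coeff (S i) 2 / z\<^sup>2 + \<rho>1 i z) * z ^ (2 * m))"
    using choice[OF allI[OF column1_expansion], of "\<lambda>i. i"] by (elim exE) (rule that)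
  obtain \<rho>2 where \<rho>2: "\<forall>i. \<rho>2 i \<in> O[at_infinity](\<lambda>z. z powi (-3)) \<and>
      (\<forall>z. z \<noteq> 0 \<longrightarrow> X_raw w m s z $ i $ 2 =
       (coeff (S i) 1 + coeff (S i) 3 / z\<^sup>2 + \<rho>2 i z) * z ^ (2 * m - 2))"
    using choice[OF allI[OF column2_expansion], of "\<lambda>i. i"] by (elim exE) (rule that)
  obtain \<rho>3 where \<rho>3: "\<forall>i. \<rho>3 i \<in> O[at_infinity](\<lambda>z. z powi (-4)) \<and>
      (\<forall>\<^sub>F z in at_infinity. X_raw w m s z $ i $ 3 =
       (B_mat w m s $ i $ 3 + H_subleading $ i / z\<^sup>2 + \<rho>3 i z) * z powi (- 4 * int m + 2))"
    using choice[OF allI[OF column3_expansion], of "\<lambda>i. i"] by (elim exE) (rule that)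
  define P :: "complex \<Rightarrow> complex^3^3" where
    "P z = (\<chi> i. vector [\<rho>1 i z, \<rho>2 i z, \<rho>3 i z])" for z
  define C :: "complex^3^3" where "C = (\<chi> i. vector [coeff (S i) 2, coeff (S i) 3, H_subleading $ i])"
  define R where "R z = Binv ** P z" for z
  have P: "(\<lambda>z. P z $ i $ j) \<in> O[at_infinity](\<lambda>z. z powi (-3))"
    "(\<lambda>z. P z $ i $ 3) \<in> O[at_infinity](\<lambda>z. z powi (-4))" for i j
    using exhaust_3[of j] \<rho>1 \<rho>2 \<rho>3 landau_o.big_trans[OF _ powi_bigo_powi[of "-4" "-3"]]
    by (auto simp: P_def vector_3)
  show ?thesis
  proof (intro exI conjI allI)
    show "(\<lambda>z. R z $ i $ j) \<in> O[at_infinity](\<lambda>z. z powi (-3))" for i j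
      unfolding R_def matrix_matrix_mult_def vec_lambda_beta
      using P(1) by (intro big_sum_in_bigo) simp
    show "(\<lambda>z. R z $ i $ 3) \<in> O[at_infinity](\<lambda>z. z powi (-4))" for i
      unfolding R_def matrix_matrix_mult_def vec_lambda_beta
      using P(2) by (intro big_sum_in_bigo) simp
    have "\<forall>\<^sub>F z::complex in at_infinity. z \<noteq> 0"
      unfolding eventually_at_infinity by (intro exI[of _ 1]) auto
    moreover have "\<forall>\<^sub>F z in at_infinity. \<forall>i. X_raw w m s z $ i $ 3 =
       (B_mat w m s $ i $ 3 + H_subleading $ i / z\<^sup>2 + \<rho>3 i z) * z powi (- 4 * int m + 2)"
      using \<rho>3 by (intro eventually_all_finite) blast
    ultimately show "\<forall>\<^sub>F z in at_infinity. X_mat w m s z =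
           (\<chi> i j. Finite_Cartesian_Product.mat 1 $ i $ j + X1_inf $ i $ j / z
                    + X2 $ i $ j / z\<^sup>2 + R z $ i $ j) ** asym_mat m z"
    proof eventually_elim
      case (elim z)
      let ?B = "B_mat w m s"
      define N where "N = (\<chi> i j. ?B $ i $ j + (?B ** X1_inf) $ i $ j / z + C $ i $ j / z\<^sup>2 + P z $ i $ j)"
      have "z powi (2 * int m) = z ^ (2 * m)" "z powi (2 * int m - 2) = z ^ (2 * m - 2)"
      proof -
        have "2 * int m = int (2 * m)" "2 * int m - 2 = int (2 * m - 2)"
          using m_ge_1 by (simp_all add: of_nat_diff)
        then show "z powi (2 * int m) = z ^ (2 * m)" "z powi (2 * int m - 2) = z ^ (2 * m - 2)"
          by (simp_all only: power_int_of_nat)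
      qed
      then have "X_raw w m s z $ i $ j = N $ i $ j * asym_mat m z $ j $ j" for i j
        using exhaust_3[of j] \<rho>1[THEN spec, THEN conjunct2, rule_format, OF elim(1), of i]
          \<rho>2[THEN spec, THEN conjunct2, rule_format, OF elim(1), of i] elim(2)
        by (auto simp: N_def asym_mat_def P_def C_def B_mat_column X1_inf_def vector_3
            matrix_matrix_mult_def sum_3)
      then have X: "X_raw w m s z = N ** asym_mat m z"
        by (simp add: Finite_Cartesian_Product.vec_eq_iff mult_asym_mat)
      have inv: "Binv ** ?B = Finite_Cartesian_Product.mat 1"
        by (rule matrix_inv_left_inverse[OF invertible_B_mat])
      have "Binv ** (?B ** X1_inf) = X1_inf"
        by (simp add: matrix_mul_assoc inv)
      have "(Binv ** N) $ i $ j = (Binv ** ?B) $ i $ j + (Binv ** (?B ** X1_inf)) $ i $ j / z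
          + (Binv ** C) $ i $ j / z\<^sup>2 + (Binv ** P z) $ i $ j" for i j
        unfolding N_def matrix_matrix_mult_def[of Binv] vec_lambda_beta
        by (simp add: distrib_left sum.distrib sum_divide_distrib)
      then have "Binv ** N = (\<chi> i j. Finite_Cartesian_Product.mat 1 $ i $ j + X1_inf $ i $ j / z
                    + X2 $ i $ j / z\<^sup>2 + R z $ i $ j)"
        unfolding \<open>Binv ** (?B ** X1_inf) = X1_inf\<close> inv
        by (simp add: Finite_Cartesian_Product.vec_eq_iff X2_def C_def R_def)
      then show ?case
        by (simp add: X_mat_def X matrix_mul_assoc)
    qed
  qed
qed

lemma X_mat_column3_at_infinity:
  "\<exists>r :: complex \<Rightarrow> complex^3.
     (\<forall>i. (\<lambda>z. r z $ i) \<in> O[at_infinity](\<lambda>z. z powi (-4))) \<and>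
     (\<forall>\<^sub>F z in at_infinity. column 3 (X_mat w m s z) =
        z powi (- 4 * int m + 2) *s (e3 + (1 / z\<^sup>2) *s phi + r z))"
proof -
  obtain R :: "complex \<Rightarrow> complex^3^3" where
    "\<forall>i j. (\<lambda>z. R z $ i $ j) \<in> O[at_infinity](\<lambda>z. z powi (-3))" and
    R: "\<forall>i. (\<lambda>z. R z $ i $ 3) \<in> O[at_infinity](\<lambda>z. z powi (-4))"
    "\<forall>\<^sub>F z in at_infinity. X_mat w m s z =
           (\<chi> i j. Finite_Cartesian_Product.mat 1 $ i $ j + X1_inf $ i $ j / z
                    + X2 $ i $ j / z\<^sup>2 + R z $ i $ j) ** asym_mat m z"
    using X_mat_at_infinity by (elim exE conjE) (rule that)
  show ?thesis
  proof (intro exI[of _ "\<lambda>z. column 3 (R z)"] conjI allI)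
    show "(\<lambda>z. column 3 (R z) $ i) \<in> O[at_infinity](\<lambda>z. z powi (-4))" for i
      using R(1) by (simp add: column_def)
    show "\<forall>\<^sub>F z in at_infinity. column 3 (X_mat w m s z) =
           z powi (- 4 * int m + 2) *s (e3 + (1 / z\<^sup>2) *s phi + column 3 (R z))"
      using R(2)
    proof eventually_elim
      case (elim z)
      have "X1_inf $ i $ 3 = 0" "asym_mat m z $ 3 $ 3 = z powi (- 4 * int m + 2)"
        "Finite_Cartesian_Product.mat 1 $ i $ 3 = e3 $ i" for i
        using exhaust_3[of i]
        by (auto simp: X1_inf_def asym_mat_def vector_3 Finite_Cartesian_Product.mat_def axis_def)
      then show ?case
        unfolding elim Finite_Cartesian_Product.vec_eq_iff
        by (simp add: column_def mult_asym_mat column_X2 algebra_simps)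
    qed
  qed
qed

lemma v_coeff_eq: "v_coeff w m s j = Binv *v (\<chi> i. coeff (column1_poly i) j)"
proof -
  have "(\<lambda>z. column 1 (X_mat w m s z) $ i) = poly (\<Sum>k\<in>UNIV. [:Binv $ i $ k:] * column1_poly k)" for i
    by (rule ext) (simp add: column_def X_mat_def matrix_matrix_mult_def poly_sum poly_column1_poly)
  then have "v_coeff w m s j $ i = coeff (\<Sum>k\<in>UNIV. [:Binv $ i $ k:] * column1_poly k) j" for i
    by (simp only: v_coeff_def vec_lambda_beta taylor_coeff_poly)
  then show ?thesis
    by (simp add: Finite_Cartesian_Product.vec_eq_iff matrix_vector_mult_def coeff_sum)
qed

text \<open>As \<open>S i\<close> is monic, its reciprocal polynomial has the constant coefficient \<open>1\<close>; the power of
  \<open>z\<close> in front of it shifts this coefficient.\<close>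

lemma coeff_column1_poly:
  "j < 2 * m - row_degree m i \<Longrightarrow> coeff (column1_poly i) j = 0"
  "coeff (column1_poly i) (2 * m - row_degree m i) = 1"
proof -
  have "coeff (S_star w s (row_degree m i)) 0 = 1"
    unfolding S_star_def coeff_0_reflect_poly degree_S
    by (rule coeff_S_poly_top[OF cont_w E_det_nz])
  then show "j < 2 * m - row_degree m i \<Longrightarrow> coeff (column1_poly i) j = 0"
    "coeff (column1_poly i) (2 * m - row_degree m i) = 1"
    by (simp_all add: column1_poly_def coeff_monom_mult)
qed

text \<open>The third column of \<open>B_mat\<close> is supported in the last row.\<close>

lemma e3_eq: "e3 = Binv *v (axis 3 (- 2 * g_const w s (2 * m - 2)))"
proof -
  have "B_mat w m s *v e3 = axis 3 (- 2 * g_const w s (2 * m - 2))"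
    unfolding Finite_Cartesian_Product.vec_eq_iff
    by (simp add: matrix_vector_mult_def sum_3 B_mat_column axis_def)
  then have "Binv *v (axis 3 (- 2 * g_const w s (2 * m - 2))) = (Binv ** B_mat w m s) *v e3"
    by (simp add: matrix_vector_mul_assoc[symmetric])
  then show ?thesis
    by (simp add: matrix_inv_left_inverse[OF invertible_B_mat])
qed

text \<open>All columns are \<open>Binv\<close> times vectors that form a triangular matrix, up to the order of the
  columns, with diagonal entries among \<open>1\<close>, \<open>-2 g\<^bsub>2m-1\<^esub>\<close> and \<open>-2 g\<^bsub>2m-2\<^esub>\<close>.\<close>

lemma ranks:
  "rank (of_columns (v_coeff w m s 0) e3 phi) = 3"
  "rank (of_columns (v_coeff w m s 0) (v_coeff w m s 1) e3) = 3"
  "rank (of_columns (v_coeff w m s 0) (v_coeff w m s 1) (v_coeff w m s 2)) = 3"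
proof -
  have diffs: "2 * m - row_degree m 1 = 0" "2 * m - row_degree m 2 = 1" "2 * m - row_degree m 3 = 2"
    using m_ge_1 by auto
  have c: "coeff (column1_poly 1) 0 = 1" "coeff (column1_poly 2) 0 = 0" "coeff (column1_poly 3) 0 = 0"
    "coeff (column1_poly 2) 1 = 1" "coeff (column1_poly 3) 1 = 0" "coeff (column1_poly 3) 2 = 1"
    using coeff_column1_poly(2)[of 1] coeff_column1_poly(2)[of 2] coeff_column1_poly(2)[of 3]
      coeff_column1_poly(1)[of _ 2] coeff_column1_poly(1)[of _ 3] unfolding diffs by auto
  note inv = matrix_inv_left_inverse(2)[OF invertible_B_mat]
  show "rank (of_columns (v_coeff w m s 0) e3 phi) = 3"
    unfolding v_coeff_eq phi_def e3_eq
    by (rule rank_of_columns_mult[OF inv]) (use c g_nz in \<open>simp add: det_of_columns H_subleading_def vector_3 axis_def\<close>)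
  show "rank (of_columns (v_coeff w m s 0) (v_coeff w m s 1) e3) = 3"
    unfolding v_coeff_eq e3_eq
    by (rule rank_of_columns_mult[OF inv]) (use c g_nz in \<open>simp add: det_of_columns axis_def\<close>)
  show "rank (of_columns (v_coeff w m s 0) (v_coeff w m s 1) (v_coeff w m s 2)) = 3"
    unfolding v_coeff_eq
    by (rule rank_of_columns_mult[OF inv]) (use c in \<open>simp add: det_of_columns\<close>)
qed

end

theorem theorem5:
  fixes w :: "complex \<Rightarrow> complex" and m :: nat and s :: int
  assumes "plemelj_symbol w"
    and "m \<ge> 1"
    and "\<forall>n\<in>{2*m, 2*m - 1, 2*m - 2}. E_det w s n \<noteq> 0"
    and "(E_det w (s + 1) (2*m) * Ehat_det w s (2*m - 1)
            - E_det w (s + 1) (2*m - 1) * Ehat_det w s (2*m))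
          / (E_det w s (2*m) * E_det w s (2*m - 1)) \<noteq> 0"
  shows
    "(\<comment> \<open>the defining formula makes sense\<close>
      (\<forall>n\<in>{2*m, 2*m - 1, 2*m - 2}. \<exists>!p. is_S w s n p) \<and>
      (\<forall>n\<in>{2*m, 2*m - 1, 2*m - 2}. \<forall>z\<in>- sphere 0 1.
         (\<lambda>\<zeta>. H_integrand w s n z \<zeta> / (2 * of_real pi * \<i> * \<zeta>))
           contour_integrable_on circlepath 0 1) \<and>
      invertible (B_mat w m s)) \<and>
     \<comment> \<open>X1\<close>
     (\<forall>i j. (\<lambda>z. X_mat w m s z $ i $ j) holomorphic_on - sphere 0 1) \<and>
     \<comment> \<open>X2\<close>
     (\<exists>Xp Xm. boundary_values (X_mat w m s) Xp Xm \<and>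
        (\<forall>z\<in>sphere 0 1. Xp z = Xm z ** jump_mat w m s z)) \<and>
     \<comment> \<open>X3\<close>
     (\<exists>(X2_inf :: complex^3^3) (R :: complex \<Rightarrow> complex^3^3).
        (\<forall>i j. (\<lambda>z. R z $ i $ j) \<in> O[at_infinity](\<lambda>z. z powi (-3))) \<and>
        (\<forall>\<^sub>F z in at_infinity. X_mat w m s z =
           (\<chi> i j. Finite_Cartesian_Product.mat 1 $ i $ j + X1_inf $ i $ j / z
                    + X2_inf $ i $ j / z\<^sup>2 + R z $ i $ j) ** asym_mat m z)) \<and>
     (\<exists>(\<phi> :: complex^3) (r :: complex \<Rightarrow> complex^3).
        (\<forall>i. (\<lambda>z. r z $ i) \<in> O[at_infinity](\<lambda>z. z powi (-4))) \<and>
        (\<forall>\<^sub>F z in at_infinity. column 3 (X_mat w m s z) =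
           z powi (- 4 * int m + 2) *s (e3 + (1 / z\<^sup>2) *s \<phi> + r z)) \<and>
        rank (of_columns (v_coeff w m s 0) e3 \<phi>) = 3 \<and>
        rank (of_columns (v_coeff w m s 0) (v_coeff w m s 1) e3) = 3 \<and>
        rank (of_columns (v_coeff w m s 0) (v_coeff w m s 1) (v_coeff w m s 2)) = 3)"
proof -
  have "E_det w s (row_degree m i) \<noteq> 0" for i
    using assms(3) exhaust_3[of i] by auto
  then interpret nondegenerate_symbol w m s
    by unfold_locales (use assms in auto)
  have "\<forall>n\<in>{2*m, 2*m - 1, 2*m - 2}. \<exists>!p. is_S w s n p"
    using ex1_is_S[OF cont_w] assms(3) by blast
  moreover have "\<forall>n\<in>{2*m, 2*m - 1, 2*m - 2}. \<forall>z\<in>- sphere 0 1.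
         (\<lambda>\<zeta>. H_integrand w s n z \<zeta> / (2 * of_real pi * \<i> * \<zeta>)) contour_integrable_on circlepath 0 1"
    by (auto intro!: circle_mean_integrable continuous_on_H_integrand[OF cont_w])
  moreover have "\<exists>(X2_inf :: complex^3^3) (R :: complex \<Rightarrow> complex^3^3).
        (\<forall>i j. (\<lambda>z. R z $ i $ j) \<in> O[at_infinity](\<lambda>z. z powi (-3))) \<and>
        (\<forall>\<^sub>F z in at_infinity. X_mat w m s z =
           (\<chi> i j. Finite_Cartesian_Product.mat 1 $ i $ j + X1_inf $ i $ j / z
                    + X2_inf $ i $ j / z\<^sup>2 + R z $ i $ j) ** asym_mat m z)"
    using X_mat_at_infinity by (elim exE conjE) (intro exI conjI)
  moreover have "\<exists>(\<phi> :: complex^3) (r :: complex \<Rightarrow> complex^3).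
        (\<forall>i. (\<lambda>z. r z $ i) \<in> O[at_infinity](\<lambda>z. z powi (-4))) \<and>
        (\<forall>\<^sub>F z in at_infinity. column 3 (X_mat w m s z) =
           z powi (- 4 * int m + 2) *s (e3 + (1 / z\<^sup>2) *s \<phi> + r z)) \<and>
        rank (of_columns (v_coeff w m s 0) e3 \<phi>) = 3 \<and>
        rank (of_columns (v_coeff w m s 0) (v_coeff w m s 1) e3) = 3 \<and>
        rank (of_columns (v_coeff w m s 0) (v_coeff w m s 1) (v_coeff w m s 2)) = 3"
    using X_mat_column3_at_infinity ranks by (elim exE conjE) (intro exI conjI)
  ultimately show ?thesis
    using invertible_B_mat X_mat_holomorphic X_mat_jump by (intro conjI) blast+
qed

end
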